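(* Let $X$ be a real Banach space and let $\partial$ be a subdifferential on $X$ (in the sense of the context). Each $\partial$-essentially directionally smooth (eds) function $g:X\to\,]-\infty,+\infty]$ belongs to $\mathrm{LACG}_*(X)$ and satisfies: for every $[\bar x,\bar x+u]\subset\mathrm{dom}\, g$, $g^{\natural\natural}(\bar x+tu;u)=g^r(\bar x+tu;u)$ for almost all $t\in[0,1]$. Hence, the class of eds functions is contained in $\mathrm{LACG}_*^{\natural a}(X)$.
   Context: Throughout, $X$ is a real Banach space with dual $X^*$. All functions $f:X\to\,]-\infty,+\infty]$ are lower semicontinuous (lsc) and proper, i.e. $\mathrm{dom} f:=\{x: f(x)<\infty\}\neq\emptyset$. $[x,y]:=\{x+t(y-x):t\in[0,1]\}$, and $]x,y]$ is defined accordingly. **Convergence in a direction.** A net $(x_\nu)$ converges to $\bar x$ in the direction $v\in X$, written $x_\nu\to_v\bar x$, if there are nets $t_\nu\searrow0$ (i.e. $t_\nu\to 0$, $t_\nu>0$) and $v_\nu\to v$ with $x_\nu=\bar x+t_\nu v_\nu$. Thus $\limsup_{x\to_v\bar x}F(x)=\inf_{\varepsilon>0}\sup\{F(\bar x+tv'):0<t<\varepsilon,\|v'-v\|<\varepsilon\}$. In $\limsup_{x\to\bar x}F(x)$ the point $x=\bar x$ is allowed. **Subderivatives.** For $\bar x\in\mathrm{dom} f$, $u\in X$: $f^r(\bar x;u):=\liminf_{t\searrow0}\frac{f(\bar x+tu)-f(\bar x)}{t}$; $f^\uparrow(\bar x;u):=\sup_{\delta>0}\limsup_{t\searrow0,\,(x,f(x))\to(\bar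 x,f(\bar x))}\inf_{u'\in B_\delta(u)}\frac{f(x+tu')-f(x)}{t}$, with $B_\delta(u)$ the ball of radius $\delta$ around $u$. For $\bar x\notin\mathrm{dom} f$ these are defined to be $-\infty$. Moreover, for $\bar x\in\mathrm{dom} f$, $f^{\natural}(\bar x;u):=\inf_{\alpha\ge0}\limsup_{x\to_u\bar x}f^r(x;u+\alpha(\bar x-x))$ and $f^{\natural\natural}(\bar x;u):=\inf_{\alpha\ge0}\limsup_{x\to\bar x}f^r(x;u+\alpha(\bar x-x))$. **Subdifferential.** For $\bar x\in\mathrm{dom} f$ put $\partial_{MR}f(\bar x):=\{x^*\in X^*:\langle x^*,y-\bar x\rangle+f(\bar x)\le f(y)\ \forall y\in X\}$ and $\partial_Cf(\bar x):=\{x^*\in X^*:\langle x^*,u\rangle\le f^\uparrow(\bar x;u)\ \forall u\in X\}$ (both empty for $\bar x\notin\mathrm{dom} f$). A subdifferential is an operator $\partial$ that associates a set-valued mapping $\partial f:X\rightrightarrows X^*$ (identified with its graph) to each function $f$ on $X$ so that $\partial_{MR}f\subset\partial f\subset\partial_Cf$ and the following Separation Principle holds: for any lsc $f,\varphi$ with $\varphi$ convex and Lipschitz near $\bar x\in\mathrm{dom} f$, if $f+\varphi$ admits a local minimum at $\bar x$, then $0\in\widehat\partial f(\bar x)+\partial\varphi(\bar x)$, where $\widehat\partial f(\bar x)$ is the set of $\bar x^*\in X^*$ for which there is a net $((x_\nu,x_\nu^* ))_\nu\subset\partial f$ with $(x_\nu,f(x_\nu))\to(\bar x,f(\bar x))$,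 $x_\nu^*\to\bar x^*$ weak$^*$, and $\limsup_\nu\langle x_\nu^*,x_\nu-\bar x\rangle\le0$. **ACG$_*$.** For $\varphi:[a,b]\to\mathbb R$ let $\omega(\varphi,[c,d]):=\sup\{|\varphi(y)-\varphi(x)|:c\le x\le y\le d\}$. $\varphi$ is AC$_*$ on $S\subset[a,b]$ if for each $\varepsilon>0$ there is $\delta>0$ such that $\sum_{i=1}^n\omega(\varphi,[c_i,d_i])<\varepsilon$ whenever $\{[c_i,d_i]\}_{i=1}^n$ is a finite collection of non-overlapping intervals with endpoints in $S$ and $\sum(d_i-c_i)<\delta$. $\varphi$ is ACG$_*$ on $S$ if $\varphi|_S$ is continuous and $S$ is a countable union of sets on each of which $\varphi$ is AC$_*$. **Classes of functions.** $\mathrm{LACG}_*(X)$ is the class of (proper) lsc functions $f$ on $X$ whose restrictions to line segments $[a,b]\subset\mathrm{dom} f$ are ACG$_*$ (i.e. $t\mapsto f(a+t(b-a))$ is ACG$_*$ on $[0,1]$). $\mathrm{LACG}_*^{\natural a}(X)$ is the class of $g\in\mathrm{LACG}_*(X)$ with $\mathrm{dom}\, g$ convex such that for all $[\bar x,\bar x+u]\subset\mathrm{dom}\, g$, $g^{\natural}(\bar x+tu;u)=g^r(\bar x+tu;u)$ for (Lebesgue) almost all $t\in[0,1]$. **Essentially directionally smooth functions.** A lsc function $g:X\to\,]-\infty,+\infty]$ is $\partial$-essentially directionally smooth (eds) if for every $u,v\in\mathrm{dom}\, g$ with $v\ne u$: (i) the function $t\mapsto g_{u,v}(t):=g(u+t(v-u))$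 is finite and continuous on $[0,1]$; (ii) there are real numbers $0=t_0<\cdots<t_p=1$ such that $g_{u,v}$ is absolutely continuous on each closed interval included in $[0,1]\setminus\{t_0,t_1,\ldots,t_p\}$; (iii) for every $\mu>0$ there exists a subset $T_\mu\subset[0,1]$ of Lebesgue measure 1 such that for every $t\in T_\mu$ and every sequence $((x_k,x_k^* ))_k\subset\partial g$ with $x_k\to x(t):=u+t(v-u)$, there is some $w\in\,]x(t),v]$ for which $$\limsup_{k\to\infty}\langle x_k^*,w-x_k\rangle\le\|w-x(t)\|\left(\|v-u\|^{-1}g_{u,v}^r(t;1)+\mu\right),$$ where $g_{u,v}^r(t;1)$ is the radial subderivative of $g_{u,v}$ at $t$ in the direction $1$. *)

theory Defs
  imports "HOL-Analysis.Analysis"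
begin

subsection \<open>Extended-real-valued functions\<close>

definition edom :: "('a \<Rightarrow> ereal) \<Rightarrow> 'a set"
  where "edom f = {x. f x < \<infinity>}"

definition proper :: "('a \<Rightarrow> ereal) \<Rightarrow> bool"
  where "proper f \<longleftrightarrow> (\<forall>x. f x \<noteq> -\<infinity>) \<and> edom f \<noteq> {}"

definition lsc :: "('a::topological_space \<Rightarrow> ereal) \<Rightarrow> bool"
  where "lsc f \<longleftrightarrow> (\<forall>x. f x \<le> Liminf (nhds x) f)"

definition lsc_proper :: "('a::topological_space \<Rightarrow> ereal) \<Rightarrow> bool"
  where "lsc_proper f \<longleftrightarrow> lsc f \<and> proper f"

definition econvex :: "('a::real_vector \<Rightarrow> ereal) \<Rightarrow> bool"
  where "econvex f \<longleftrightarrow>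
    (\<forall>x y. \<forall>s\<in>{0<..<1::real}. f ((1 - s) *\<^sub>R x + s *\<^sub>R y) \<le> ereal (1 - s) * f x + ereal s * f y)"

definition lipschitz_near :: "('a::metric_space \<Rightarrow> ereal) \<Rightarrow> 'a \<Rightarrow> bool"
  where "lipschitz_near f x \<longleftrightarrow>
    (\<exists>e>0. \<exists>L. (\<forall>y\<in>ball x e. \<bar>f y\<bar> \<noteq> \<infinity>) \<and> L-lipschitz_on (ball x e) (\<lambda>y. real_of_ereal (f y)))"


subsection \<open>Subderivatives\<close>

text \<open>Net limits are expressed through filters. The filter \<open>at_direction x v\<close> describes
  \<open>y = x + t w\<close> with \<open>t\<close> decreasing to \<open>0\<close> and \<open>w\<close> tending to \<open>v\<close>; the value \<open>w = v\<close> is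
  allowed.\<close>

definition at_direction :: "'a::real_normed_vector \<Rightarrow> 'a \<Rightarrow> 'a filter"
  where "at_direction x v =
    filtermap (\<lambda>(t::real, w). x + t *\<^sub>R w) (at_right 0 \<times>\<^sub>F nhds v)"

definition radial_subderiv :: "('a::real_normed_vector \<Rightarrow> ereal) \<Rightarrow> 'a \<Rightarrow> 'a \<Rightarrow> ereal"
  where "radial_subderiv f x u =
    (if x \<in> edom f
     then Liminf (at_right 0) (\<lambda>t::real. (f (x + t *\<^sub>R u) - f x) / ereal t)
     else -\<infinity>)"

text \<open>The filter for \<open>(x, f x) \<rightarrow> (xbar, f xbar)\<close>.\<close>

definition graph_nhds :: "('a::topological_space \<Rightarrow> ereal) \<Rightarrow> 'a \<Rightarrow> 'a filter"
  where "graph_nhds f xbar = inf (nhds xbar) (filtercomap f (nhds (f xbar)))"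

definition clarke_subderiv :: "('a::real_normed_vector \<Rightarrow> ereal) \<Rightarrow> 'a \<Rightarrow> 'a \<Rightarrow> ereal"
  where "clarke_subderiv f xbar u =
    (if xbar \<in> edom f
     then SUP \<delta>\<in>{0<..}. Limsup (at_right (0::real) \<times>\<^sub>F graph_nhds f xbar)
            (\<lambda>(t, x). INF u'\<in>ball u \<delta>. (f (x + t *\<^sub>R u') - f x) / ereal t)
     else -\<infinity>)"

text \<open>The next two are only meaningful at points of \<open>edom f\<close>. Since \<open>nhds xbar\<close> is not
  punctured, \<open>x = xbar\<close> is allowed in the second one.\<close>

definition nat_subderiv :: "('a::real_normed_vector \<Rightarrow> ereal) \<Rightarrow> 'a \<Rightarrow> 'a \<Rightarrow> ereal"
  where "nat_subderiv f xbar u =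
    (INF \<alpha>\<in>{0::real..}. Limsup (at_direction xbar u)
       (\<lambda>x. radial_subderiv f x (u + \<alpha> *\<^sub>R (xbar - x))))"

definition natnat_subderiv :: "('a::real_normed_vector \<Rightarrow> ereal) \<Rightarrow> 'a \<Rightarrow> 'a \<Rightarrow> ereal"
  where "natnat_subderiv f xbar u =
    (INF \<alpha>\<in>{0::real..}. Limsup (nhds xbar)
       (\<lambda>x. radial_subderiv f x (u + \<alpha> *\<^sub>R (xbar - x))))"


subsection \<open>Subdifferentials\<close>

text \<open>The dual of \<open>'a\<close> is \<open>'a \<Rightarrow>\<^sub>L real\<close>.\<close>

definition MR_subdiff :: "('a::real_normed_vector \<Rightarrow> ereal) \<Rightarrow> 'a \<Rightarrow> ('a \<Rightarrow>\<^sub>L real) set"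
  where "MR_subdiff f x =
    (if x \<in> edom f then {x'. \<forall>y. ereal (blinfun_apply x' (y - x)) + f x \<le> f y} else {})"

definition clarke_subdiff :: "('a::real_normed_vector \<Rightarrow> ereal) \<Rightarrow> 'a \<Rightarrow> ('a \<Rightarrow>\<^sub>L real) set"
  where "clarke_subdiff f x =
    (if x \<in> edom f then {x'. \<forall>u. ereal (blinfun_apply x' u) \<le> clarke_subderiv f x u} else {})"

text \<open>For a set-valued map \<open>A\<close> (playing the role of \<open>\<partial>f\<close>), \<open>subdiff_closure A f xbar\<close> is the set
  of weak* limits of nets \<open>(x, x')\<close> in the graph of \<open>A\<close>. A net is represented by its
  (proper) filter of tails \<open>F\<close>; conversely each proper filter is the tail filter of some net.\<close>

definition subdiff_closure ::
  "('a::real_normed_vector \<Rightarrow> ('a \<Rightarrow>\<^sub>L real) set) \<Rightarrow> ('a \<Rightarrow> ereal) \<Rightarrow> 'a \<Rightarrow> ('a \<Rightarrow>\<^sub>L real) set"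
  where "subdiff_closure A f xbar =
    {xbar'. \<exists>F :: ('a \<times> ('a \<Rightarrow>\<^sub>L real)) filter.
        F \<noteq> bot \<and>
        (\<forall>\<^sub>F (x, x') in F. x' \<in> A x) \<and>
        ((\<lambda>(x, x'). x) \<longlongrightarrow> xbar) F \<and>
        ((\<lambda>(x, x'). f x) \<longlongrightarrow> f xbar) F \<and>
        (\<forall>h. ((\<lambda>(x, x'). blinfun_apply x' h) \<longlongrightarrow> blinfun_apply xbar' h) F) \<and>
        Limsup F (\<lambda>(x, x'). ereal (blinfun_apply x' (x - xbar))) \<le> 0}"

definition separation_principle ::
  "(('a::real_normed_vector \<Rightarrow> ereal) \<Rightarrow> 'a \<Rightarrow> ('a \<Rightarrow>\<^sub>L real) set) \<Rightarrow> bool"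
  where "separation_principle D \<longleftrightarrow>
    (\<forall>f \<phi> xbar. lsc_proper f \<and> lsc_proper \<phi> \<and> xbar \<in> edom f \<and>
        econvex \<phi> \<and> lipschitz_near \<phi> xbar \<and>
        (\<forall>\<^sub>F x in nhds xbar. f xbar + \<phi> xbar \<le> f x + \<phi> x) \<longrightarrow>
      (\<exists>x'\<in>subdiff_closure (D f) f xbar. \<exists>y'\<in>D \<phi> xbar. 0 = x' + y'))"

definition subdifferential ::
  "(('a::real_normed_vector \<Rightarrow> ereal) \<Rightarrow> 'a \<Rightarrow> ('a \<Rightarrow>\<^sub>L real) set) \<Rightarrow> bool"
  where "subdifferential D \<longleftrightarrow>
    (\<forall>f. lsc_proper f \<longrightarrow> (\<forall>x. MR_subdiff f x \<subseteq> D f x \<and> D f x \<subseteq> clarke_subdiff f x)) \<and>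
    separation_principle D"


subsection \<open>Absolute continuity\<close>

text \<open>Finite collections \<open>[c i, d i]\<close>, \<open>i < n\<close>, of non-overlapping intervals with endpoints in \<open>S\<close>.\<close>

definition nonoverlapping_in :: "real set \<Rightarrow> nat \<Rightarrow> (nat \<Rightarrow> real) \<Rightarrow> (nat \<Rightarrow> real) \<Rightarrow> bool"
  where "nonoverlapping_in S n c d \<longleftrightarrow>
    (\<forall>i<n. c i \<in> S \<and> d i \<in> S \<and> c i \<le> d i) \<and>
    (\<forall>i<n. \<forall>j<n. i \<noteq> j \<longrightarrow> {c i<..<d i} \<inter> {c j<..<d j} = {})"

definition abs_cont_on :: "real set \<Rightarrow> (real \<Rightarrow> real) \<Rightarrow> bool"
  where "abs_cont_on S \<phi> \<longleftrightarrow>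
    (\<forall>\<epsilon>>0. \<exists>\<delta>>0. \<forall>n c d. nonoverlapping_in S n c d \<and> (\<Sum>i<n. d i - c i) < \<delta> \<longrightarrow>
       (\<Sum>i<n. \<bar>\<phi> (d i) - \<phi> (c i)\<bar>) < \<epsilon>)"

text \<open>The oscillation may be infinite, hence is taken in \<open>ereal\<close>.\<close>

definition oscillation :: "(real \<Rightarrow> real) \<Rightarrow> real \<Rightarrow> real \<Rightarrow> ereal"
  where "oscillation \<phi> c d = Sup {ereal \<bar>\<phi> y - \<phi> x\<bar> | x y. c \<le> x \<and> x \<le> y \<and> y \<le> d}"

definition AC_star_on :: "real set \<Rightarrow> (real \<Rightarrow> real) \<Rightarrow> bool"
  where "AC_star_on S \<phi> \<longleftrightarrow>
    (\<forall>\<epsilon>>0. \<exists>\<delta>>0. \<forall>n c d. nonoverlapping_in S n c d \<and> (\<Sum>i<n. d i - c i) < \<delta> \<longrightarrow>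
       (\<Sum>i<n. oscillation \<phi> (c i) (d i)) < ereal \<epsilon>)"

definition ACG_star_on :: "real set \<Rightarrow> (real \<Rightarrow> real) \<Rightarrow> bool"
  where "ACG_star_on S \<phi> \<longleftrightarrow> continuous_on S \<phi> \<and>
    (\<exists>E :: nat \<Rightarrow> real set. S = (\<Union>k. E k) \<and> (\<forall>k. AC_star_on (E k) \<phi>))"


subsection \<open>Classes of functions\<close>

definition LACG_star :: "('a::real_normed_vector \<Rightarrow> ereal) set"
  where "LACG_star = {f. lsc_proper f \<and>
    (\<forall>a b. closed_segment a b \<subseteq> edom f \<longrightarrow>
       ACG_star_on {0..1} (\<lambda>t. real_of_ereal (f (a + t *\<^sub>R (b - a)))))}"

definition LACG_star_nat_ae :: "('a::real_normed_vector \<Rightarrow> ereal) set"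
  where "LACG_star_nat_ae = {g \<in> LACG_star. convex (edom g) \<and>
    (\<forall>xbar u. closed_segment xbar (xbar + u) \<subseteq> edom g \<longrightarrow>
       (AE t\<in>{0..1} in lebesgue.
          nat_subderiv g (xbar + t *\<^sub>R u) u = radial_subderiv g (xbar + t *\<^sub>R u) u))}"

text \<open>The segment \<open>]x, y]\<close>.\<close>

definition left_open_segment :: "'a::real_vector \<Rightarrow> 'a \<Rightarrow> 'a set"
  where "left_open_segment x y = {x + t *\<^sub>R (y - x) | t::real. 0 < t \<and> t \<le> 1}"

definition on_line :: "('a::real_vector \<Rightarrow> ereal) \<Rightarrow> 'a \<Rightarrow> 'a \<Rightarrow> real \<Rightarrow> ereal"
  where "on_line g u v t = g (u + t *\<^sub>R (v - u))"

definition eds ::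
  "(('a::real_normed_vector \<Rightarrow> ereal) \<Rightarrow> 'a \<Rightarrow> ('a \<Rightarrow>\<^sub>L real) set) \<Rightarrow> ('a \<Rightarrow> ereal) \<Rightarrow> bool"
  where "eds D g \<longleftrightarrow> lsc_proper g \<and>
    (\<forall>u\<in>edom g. \<forall>v\<in>edom g. v \<noteq> u \<longrightarrow>
      (\<forall>t\<in>{0..1}. \<bar>on_line g u v t\<bar> \<noteq> \<infinity>) \<and> continuous_on {0..1} (on_line g u v) \<and>
      (\<exists>(p::nat) \<tau>. \<tau> 0 = 0 \<and> \<tau> p = 1 \<and> (\<forall>i<p. \<tau> i < \<tau> (Suc i)) \<and>
         (\<forall>c d. {c..d} \<subseteq> {0..1} - \<tau> ` {..p} \<longrightarrow>
            abs_cont_on {c..d} (\<lambda>t. real_of_ereal (on_line g u v t)))) \<and>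
      (\<forall>\<mu>>0. \<exists>T. T \<subseteq> {0..1} \<and> T \<in> sets lebesgue \<and> measure lebesgue T = 1 \<and>
         (\<forall>t\<in>T. \<forall>(x :: nat \<Rightarrow> 'a) x'.
            (\<forall>k. x' k \<in> D g (x k)) \<and> x \<longlonglongrightarrow> u + t *\<^sub>R (v - u) \<longrightarrow>
            (\<exists>w\<in>left_open_segment (u + t *\<^sub>R (v - u)) v.
               limsup (\<lambda>k. ereal (blinfun_apply (x' k) (w - x k)))
               \<le> ereal (norm (w - (u + t *\<^sub>R (v - u)))) *
                 (ereal (inverse (norm (v - u))) * radial_subderiv (on_line g u v) t 1
                  + ereal \<mu>)))))"

end

theory Submission
  imports Defs
begin

text \<open>
  Along a segment of its domain an eds function \<open>g\<close> is continuous, and absolutely continuous away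
  from finitely many points, so that ACG* follows by exhausting the complement of these points by
  countably many compact intervals (\<open>ACG_star_on_off_finite\<close>).

  Both \<open>nat_subderiv\<close> and \<open>natnat_subderiv\<close> dominate the radial subderivative at every point of the
  segment but the last: the former by a mean value argument along the segment
  (\<open>radial_subderiv_le_nat\<close>), the latter because the upper limit sees the point itself. Since
  \<open>nat_subderiv\<close> is at most \<open>natnat_subderiv\<close>, all that remains is to bound \<open>natnat_subderiv\<close> from
  above by the radial subderivative almost everywhere.

  The third property of eds functions bounds from above the values of subgradients near almost every
  point \<open>y\<close> of the segment, so the upper bound needs a way from radial subderivatives to
  subgradients. This is \<open>subgradient_beyond_radial_subderiv\<close>: if \<open>c < f\<^sup>r(a; v)\<close>, then near \<open>a\<close> there
  is a subgradient \<open>x'\<close> of \<open>f\<close> at some \<open>x\<close> with \<open>x'(v + \<alpha>(a - x)) > c\<close>. It is a Zagrodny-type mean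
  value theorem in which the mean point is \<open>a\<close> itself. Indeed, if \<open>l v\<close> lies strictly between \<open>c\<close> and
  the subderivative, then \<open>f - l\<close>, restricted to a short segment issuing from \<open>a\<close> in the direction
  \<open>v\<close>, is minimal at \<open>a\<close>. Adding a large multiple of the distance to this segment and applying
  Ekeland's principle gives an unrestricted local minimum nearby, and the separation principle turns
  it into a subgradient.

  The second difficulty is that the eds property provides, for each sequence of subgradients, a
  slope \<open>\<alpha>\<close> depending on that sequence, whereas \<open>natnat_subderiv\<close> asks for one \<open>\<alpha>\<close> that is good for
  all points near \<open>y\<close>. If each \<open>\<alpha>\<close> is bad for some sequence, then, as the quantity in question is
  affine in \<open>\<alpha>\<close>, a sequence that is bad for \<open>\<alpha>\<close> can be chosen to be bad for all smaller or for all
  larger slopes as well. Hence countably many sequences are together bad for all slopes, and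
  interleaving them produces a single sequence that contradicts the eds property
  (\<open>uniform_slope\<close>).
\<close>

section \<open>Lower semicontinuity and Ekeland's variational principle\<close>

lemma lsc_eventually_gt: "lsc f \<Longrightarrow> c < f x \<Longrightarrow> \<forall>\<^sub>F y in nhds x. c < f y"
  unfolding lsc_def by (rule less_LiminfD, erule less_le_trans, simp)

lemma closed_lsc_le_continuous:
  fixes h :: "'a::topological_space \<Rightarrow> real"
  assumes "lsc f" and h: "continuous_on UNIV h"
  shows "closed {w. f w \<le> ereal (h w)}"
proof -
  have "open {w. ereal (h w) < f w}"
    unfolding open_subopen[of "{w. ereal (h w) < f w}"]
  proof (intro ballI)
    fix x assume "x \<in> {w. ereal (h w) < f w}"
    then obtain q where q: "h x < q" "ereal q < f x"
      using ereal_dense2 by (metis ereal_less(2) less_ereal.simps(1) mem_Collect_eq)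
    have "\<forall>\<^sub>F y in nhds x. h y < q"
      using h q(1) by (intro order_tendstoD(2)[where y = "h x"])
        (auto simp: continuous_on_def tendsto_at_iff_tendsto_nhds)
    with lsc_eventually_gt[OF \<open>lsc f\<close> q(2)]
    have "\<forall>\<^sub>F y in nhds x. ereal (h y) < f y"
      by eventually_elim (meson less_ereal.simps(1) less_trans)
    then show "\<exists>T. open T \<and> x \<in> T \<and> T \<subseteq> {w. ereal (h w) < f w}"
      unfolding eventually_nhds by blast
  qed
  moreover have "{w. f w \<le> ereal (h w)} = - {w. ereal (h w) < f w}" by auto
  ultimately show ?thesis by (simp add: closed_def)
qed

lemma lsc_proper_continuous:
  fixes h :: "'a::topological_space \<Rightarrow> real"
  assumes h: "continuous_on UNIV h"
  shows "lsc_proper (\<lambda>x. ereal (h x))"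
proof -
  have "Liminf (nhds x) (\<lambda>y. ereal (h y)) = ereal (h x)" for x
    using h by (intro lim_imp_Liminf) (simp_all add: continuous_on_def tendsto_at_iff_tendsto_nhds)
  then show ?thesis
    by (simp add: lsc_proper_def lsc_def proper_def edom_def)
qed

lemma econvex_ereal:
  assumes "convex_on UNIV h" shows "econvex (\<lambda>x. ereal (h x))"
  using assms unfolding econvex_def convex_on_def by auto

text \<open>Ekeland's principle for a real function on a set. Lower semicontinuity enters only through the
  sets \<open>T x\<close> of those \<open>w\<close> that lie below \<open>x\<close> in the order given by \<open>G w + \<rho> dist w x \<le> G x\<close>, and is
  therefore assumed as closedness of sets of this form; \<open>S\<close> can then be a sublevel set of an
  extended-valued function, on which the function is finite.

  Each \<open>x\<^sub>n\<^sub>+\<^sub>1\<close> is chosen almost minimal in \<open>T x\<^sub>n\<close>, which makes the diameters of these nested sets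
  tend to \<open>0\<close>; their common point is minimal in the order.\<close>

lemma ekeland:
  fixes G :: "'a::complete_space \<Rightarrow> real"
  assumes lev: "\<And>x c. x \<in> S \<Longrightarrow> closed {w\<in>S. G w + \<rho> * dist w x \<le> c}"
    and bdd: "\<And>w. w \<in> S \<Longrightarrow> m \<le> G w"
    and a: "a \<in> S" "G a \<le> m + \<rho> * r" and \<rho>: "\<rho> > 0"
  shows "\<exists>z\<in>S. dist z a \<le> r \<and> (\<forall>w\<in>S. G z \<le> G w + \<rho> * dist w z)"
proof -
  define T where "T x = {w\<in>S. G w + \<rho> * dist w x \<le> G x}" for x
  have T_self: "x \<in> T x" if "x \<in> S" for x using that by (simp add: T_def)
  have T_sub: "T w \<subseteq> T x" if "w \<in> T x" for w x
  proof
    fix v assume "v \<in> T w"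
    moreover have "\<rho> * dist v x \<le> \<rho> * dist v w + \<rho> * dist w x"
      using \<rho> dist_triangle[of v x w] by (simp flip: distrib_left)
    ultimately show "v \<in> T x" using that by (auto simp: T_def)
  qed
  have step: "\<exists>y\<in>T x. \<forall>w\<in>T x. G y \<le> G w + inverse (Suc n)" if "x \<in> S" for x and n :: nat
  proof -
    have ne: "G ` T x \<noteq> {}" using T_self[OF that] by auto
    have bb: "bdd_below (G ` T x)" using bdd by (auto simp: T_def bdd_below_def)
    have "Inf (G ` T x) < Inf (G ` T x) + inverse (Suc n)" by simp
    then obtain y where "y \<in> T x" "G y < Inf (G ` T x) + inverse (Suc n)"
      using cInf_lessD[OF ne] by blast
    moreover have "Inf (G ` T x) \<le> G w" if "w \<in> T x" for w
      using bb that by (intro cInf_lower) auto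
    ultimately show ?thesis by force
  qed
  have "\<exists>xs. \<forall>n. (xs n \<in> S \<and> (n = 0 \<longrightarrow> xs n = a)) \<and> (xs (Suc n) \<in> T (xs n) \<and>
      (\<forall>w\<in>T (xs n). G (xs (Suc n)) \<le> G w + inverse (Suc n)))"
  proof (rule dependent_nat_choice)
    show "\<exists>x. x \<in> S \<and> (0 = (0::nat) \<longrightarrow> x = a)" using a by blast
    fix x and n :: nat assume "x \<in> S \<and> (n = 0 \<longrightarrow> x = a)"
    then obtain y where "y \<in> T x" "\<forall>w\<in>T x. G y \<le> G w + inverse (Suc n)"
      using step[of x n] by blast
    moreover from this have "y \<in> S" by (simp add: T_def)
    ultimately show "\<exists>y. (y \<in> S \<and> (Suc n = 0 \<longrightarrow> y = a)) \<and> y \<in> T x \<and>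
       (\<forall>w\<in>T x. G y \<le> G w + inverse (Suc n))" by blast
  qed
  then obtain xs where xs0: "xs 0 = a" and xsS: "\<And>n. xs n \<in> S"
    and xsT: "\<And>n. xs (Suc n) \<in> T (xs n)"
    and xsG: "\<And>n w. w \<in> T (xs n) \<Longrightarrow> G (xs (Suc n)) \<le> G w + inverse (Suc n)"
    by blast
  \<comment> \<open>On \<open>T x\<^sub>n\<^sub>+\<^sub>1\<close> the function can drop below \<open>G x\<^sub>n\<^sub>+\<^sub>1\<close> by at most \<open>1/(n+1)\<close>.\<close>
  have small: "\<exists>n. \<forall>x\<in>T (xs n). \<forall>y\<in>T (xs n). dist x y < \<epsilon>" if "\<epsilon> > 0" for \<epsilon>
  proof -
    obtain n where n: "inverse (Suc n) < \<rho> * \<epsilon> / 2"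
      using reals_Archimedean[of "\<rho> * \<epsilon> / 2"] \<rho> \<open>\<epsilon> > 0\<close> by auto
    have "dist w (xs (Suc n)) < \<epsilon> / 2" if w: "w \<in> T (xs (Suc n))" for w
    proof -
      have "G (xs (Suc n)) \<le> G w + inverse (Suc n)"
        using xsG w T_sub xsT by blast
      then have "\<rho> * dist w (xs (Suc n)) \<le> inverse (Suc n)" using w by (auto simp: T_def)
      then have "\<rho> * dist w (xs (Suc n)) < \<rho> * (\<epsilon> / 2)" using n by simp
      then show ?thesis using \<rho> by simp
    qed
    then have "dist x y < \<epsilon>" if "x \<in> T (xs (Suc n))" "y \<in> T (xs (Suc n))" for x y
      using dist_triangle_half_l[of x "xs (Suc n)" \<epsilon> y] that by blast
    then show ?thesis by blast
  qed
  obtain z where z: "\<And>n. z \<in> T (xs n)"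
  proof (rule decreasing_closed_nest[of "\<lambda>n. T (xs n)"])
    show "closed (T (xs n))" for n using lev xsS by (simp add: T_def)
    show "T (xs n) \<noteq> {}" for n using xsT by blast
    show "T (xs n) \<subseteq> T (xs m)" if "m \<le> n" for m n
      using that
    proof (induction rule: dec_induct)
      case (step n)
      then show ?case using T_sub[OF xsT[of n]] by blast
    qed simp
    show "\<exists>n. \<forall>x\<in>T (xs n). \<forall>y\<in>T (xs n). dist x y < \<epsilon>" if "\<epsilon> > 0" for \<epsilon>
      using small[OF that] .
  qed blast
  have zS: "z \<in> S" using z by (auto simp: T_def)
  have "G z + \<rho> * dist z a \<le> G a" using z[of 0] xs0 by (simp add: T_def)
  then have "\<rho> * dist z a \<le> \<rho> * r" using bdd[OF zS] a by linarith
  then have "dist z a \<le> r" using \<rho> by simp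
  moreover have "G z \<le> G w + \<rho> * dist w z" if "w \<in> S" for w
  proof (rule ccontr)
    assume neg: "\<not> ?thesis"
    then have "w \<in> T z" using that by (simp add: T_def)
    then have "w \<in> T (xs n)" for n using T_sub z by blast
    then have "\<not> 0 < dist w z" using small[of "dist w z"] z by blast
    then show False using neg by simp
  qed
  ultimately show ?thesis using zS by blast
qed

section \<open>Convex functions and the separation principle\<close>

text \<open>In the definition of the Clarke subderivative at \<open>z\<close>, base points \<open>x\<close> near \<open>z\<close> may be moved in the
  nearby direction \<open>u + (z - x)\<close>, which points exactly at \<open>z + u\<close>. Convexity then bounds the difference
  quotient by \<open>h (z + u) - h x\<close>, so Clarke subgradients of convex functions are subgradients in the
  sense of convex analysis.\<close>

lemma clarke_subgradient_convex:
  fixes h :: "'a::real_normed_vector \<Rightarrow> real"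
  assumes conv: "convex_on UNIV h" and x': "x' \<in> clarke_subdiff (\<lambda>x. ereal (h x)) z"
  shows "blinfun_apply x' u \<le> h (z + u) - h z"
proof -
  let ?f = "\<lambda>x. ereal (h x)"
  have "clarke_subderiv ?f z u \<le> ereal (h (z + u) - h z)"
  proof -
    have "Limsup (at_right (0::real) \<times>\<^sub>F graph_nhds ?f z)
            (\<lambda>(t, x). INF u'\<in>ball u \<delta>. (?f (x + t *\<^sub>R u') - ?f x) / ereal t)
          \<le> ereal (h (z + u) - h z)" if "\<delta> > 0" for \<delta>
      unfolding Limsup_le_iff
    proof (intro allI impI)
      fix y assume y: "ereal (h (z + u) - h z) < y"
      then obtain y' where y': "h (z + u) - h z < y'" "ereal y' \<le> y"
        by (cases y) (use gt_ex in auto)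
      have 1: "\<forall>\<^sub>F t in at_right (0::real). 0 < t \<and> t < 1"
        by (auto simp: eventually_at_right_field intro: exI[of _ 1])
      have "\<forall>\<^sub>F x in graph_nhds ?f z. ereal (h (z + u) - y') < ?f x"
        unfolding graph_nhds_def
        by (rule filter_leD[OF inf_le2], rule eventually_filtercomapI,
            rule eventually_nhds_in_open[of "{ereal (h (z + u) - y')<..}", simplified]) (use y' in auto)
      moreover have "\<forall>\<^sub>F x in graph_nhds ?f z. dist x z < \<delta>"
        unfolding graph_nhds_def
        by (rule filter_leD[OF inf_le1]) (metis eventually_nhds_metric that)
      ultimately have 2: "\<forall>\<^sub>F x in graph_nhds ?f z. h (z + u) - h x < y' \<and> dist x z < \<delta>"
        by eventually_elim auto
      show "\<forall>\<^sub>F p in at_right (0::real) \<times>\<^sub>F graph_nhds ?f z.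
          (case p of (t, x) \<Rightarrow> INF u'\<in>ball u \<delta>. (?f (x + t *\<^sub>R u') - ?f x) / ereal t) < y"
        using eventually_prodI[OF 1 2]
      proof eventually_elim
        case (elim p)
        obtain t x where p: "p = (t, x)" by fastforce
        have t: "0 < t" "t < 1" and hx: "h (z + u) - h x < y'" and d: "dist x z < \<delta>"
          using elim by (auto simp: p)
        have "h ((1 - t) *\<^sub>R x + t *\<^sub>R (z + u)) \<le> (1 - t) * h x + t * h (z + u)"
          using convex_onD[OF conv, of t x "z + u"] t by simp
        moreover have "(1 - t) *\<^sub>R x + t *\<^sub>R (z + u) = x + t *\<^sub>R (u + (z - x))"
          by (simp add: algebra_simps)
        ultimately have "h (x + t *\<^sub>R (u + (z - x))) - h x \<le> t * (h (z + u) - h x)"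
          by (simp add: algebra_simps)
        then have "(h (x + t *\<^sub>R (u + (z - x))) - h x) / t \<le> h (z + u) - h x"
          using t by (simp add: field_simps)
        then have "(?f (x + t *\<^sub>R (u + (z - x))) - ?f x) / ereal t < ereal y'"
          using t hx by simp
        moreover have "u + (z - x) \<in> ball u \<delta>" using d by (simp add: dist_norm norm_minus_commute)
        ultimately have "(INF u'\<in>ball u \<delta>. (?f (x + t *\<^sub>R u') - ?f x) / ereal t) < ereal y'"
          by (meson INF_lower le_less_trans)
        then show ?case using y'(2) by (simp add: p)
      qed
    qed
    then show ?thesis by (simp add: clarke_subderiv_def edom_def SUP_le_iff)
  qed
  moreover have "ereal (blinfun_apply x' u) \<le> clarke_subderiv ?f z u"
    using x' by (simp add: clarke_subdiff_def edom_def)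
  ultimately show ?thesis by (meson ereal_less_eq(3) order_trans)
qed

text \<open>The form in which the separation principle is used: the subgradient of the convex summand has
  been eliminated in favour of the inequality that it satisfies.\<close>

lemma subdifferential_convex_sum_rule:
  fixes D :: "('a::real_normed_vector \<Rightarrow> ereal) \<Rightarrow> 'a \<Rightarrow> ('a \<Rightarrow>\<^sub>L real) set" and h :: "'a \<Rightarrow> real"
  assumes D: "subdifferential D" and f: "lsc_proper f" and z: "z \<in> edom f"
    and conv: "convex_on UNIV h" and lip: "L-lipschitz_on UNIV h"
    and min: "\<forall>\<^sub>F x in nhds z. f z + ereal (h z) \<le> f x + ereal (h x)"
  shows "\<exists>x'\<in>subdiff_closure (D f) f z. \<forall>u. h z - h (z + u) \<le> blinfun_apply x' u"
proof -
  have cont: "continuous_on UNIV h"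
    using lip by (rule lipschitz_on_continuous_on)
  have proper_h: "lsc_proper (\<lambda>x. ereal (h x))" by (rule lsc_proper_continuous[OF cont])
  have "lipschitz_near (\<lambda>x. ereal (h x)) z"
    unfolding lipschitz_near_def using lipschitz_on_subset[OF lip, of "ball z 1"]
    by (intro exI[of _ 1] conjI exI[of _ L]) auto
  then obtain x' y' where x': "x' \<in> subdiff_closure (D f) f z"
    and y': "y' \<in> D (\<lambda>x. ereal (h x)) z" and sum: "0 = x' + y'"
    using D f z proper_h econvex_ereal[OF conv] min
    unfolding subdifferential_def separation_principle_def by blast
  have "y' \<in> clarke_subdiff (\<lambda>x. ereal (h x)) z"
    using D y' proper_h unfolding subdifferential_def by blast
  then have "blinfun_apply y' u \<le> h (z + u) - h z" for u
    by (rule clarke_subgradient_convex[OF conv])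
  moreover have "blinfun_apply x' u = - blinfun_apply y' u" for u
    using sum by (metis add.inverse_unique add.commute uminus_blinfun.rep_eq)
  ultimately show ?thesis using x' by (intro bexI[of _ x']) (auto simp: algebra_simps)
qed

text \<open>A substitute for the Hahn-Banach theorem: the separation principle, applied to \<open>- norm\<close> and \<open>norm\<close>,
  whose sum is constant, yields a functional that does not vanish at \<open>v\<close>.\<close>

lemma exists_functional_with_value:
  fixes D :: "('a::real_normed_vector \<Rightarrow> ereal) \<Rightarrow> 'a \<Rightarrow> ('a \<Rightarrow>\<^sub>L real) set"
  assumes D: "subdifferential D" and v: "v \<noteq> 0"
  obtains l :: "'a \<Rightarrow>\<^sub>L real" where "blinfun_apply l v = c"
proof -
  let ?f = "\<lambda>x::'a. ereal (- norm x)"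
  have "lsc_proper ?f" by (intro lsc_proper_continuous continuous_intros)
  moreover have "convex_on UNIV (norm :: 'a \<Rightarrow> real)"
    using convex_on_dist[of UNIV "0::'a"] by simp
  moreover have "1-lipschitz_on UNIV (norm :: 'a \<Rightarrow> real)"
    by (auto intro!: lipschitz_onI simp: dist_norm norm_triangle_ineq3)
  ultimately obtain x' where x': "\<And>u. norm v - norm (v + u) \<le> blinfun_apply x' u"
    using subdifferential_convex_sum_rule[OF D, of ?f v norm 1] by (auto simp: edom_def)
  have "blinfun_apply x' v \<noteq> 0" 
  proof
    assume "blinfun_apply x' v = 0"
    then have "norm v \<le> 0" using x'[of "-v"] by (simp add: blinfun.minus_right)
    then show False using v by simp
  qed
  then have "blinfun_apply ((c / blinfun_apply x' v) *\<^sub>R x') v = c"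
    by (simp add: blinfun.scaleR_left)
  then show ?thesis by (rule that)
qed

lemma infdist_attained:
  assumes "compact C" "C \<noteq> {}"
  shows "\<exists>q\<in>C. infdist z C = dist z q"
proof -
  obtain q where q: "q \<in> C" "\<forall>y\<in>C. dist z q \<le> dist z y"
    using continuous_attains_inf[of C "dist z"] assms continuous_on_dist[OF continuous_on_const continuous_on_id]
    by auto
  moreover have "dist z q \<le> infdist z C"
    using q assms by (auto simp: infdist_notempty intro: cINF_greatest)
  ultimately show ?thesis using infdist_le by (metis order_antisym)
qed

lemma convex_on_infdist:
  fixes C :: "'a::real_normed_vector set"
  assumes "compact C" "convex C" "C \<noteq> {}"
  shows "convex_on UNIV (\<lambda>x. infdist x C)"
  unfolding convex_on_def
proof (intro conjI ballI allI impI)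
  fix x y :: 'a and u v :: real assume uv: "0 \<le> u" "0 \<le> v" "u + v = 1"
  obtain p q where p: "p \<in> C" "infdist x C = dist x p" and q: "q \<in> C" "infdist y C = dist y q"
    using infdist_attained[OF assms(1,3)] by metis
  have "u *\<^sub>R p + v *\<^sub>R q \<in> C" using assms(2) p q uv by (simp add: convex_def)
  then have "infdist (u *\<^sub>R x + v *\<^sub>R y) C \<le> dist (u *\<^sub>R x + v *\<^sub>R y) (u *\<^sub>R p + v *\<^sub>R q)"
    by (rule infdist_le)
  also have "\<dots> = norm (u *\<^sub>R (x - p) + v *\<^sub>R (y - q))" by (simp add: dist_norm algebra_simps)
  also have "\<dots> \<le> u * dist x p + v * dist y q"
    using uv norm_triangle_ineq[of "u *\<^sub>R (x - p)" "v *\<^sub>R (y - q)"] by (simp add: dist_norm)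
  finally show "infdist (u *\<^sub>R x + v *\<^sub>R y) C \<le> u * infdist x C + v * infdist y C"
    using p q by simp
qed simp

section \<open>A mean value inequality for subgradients\<close>

text \<open>If no \<open>K\<close> worked, points \<open>z\<^sub>n\<close> violating the inequality for \<open>K = n\<close> would approach \<open>C\<close>, because \<open>f\<close>
  is bounded below and \<open>h\<close> above; by compactness and lower semicontinuity the inequality \<open>f \<le> h\<close>
  would then hold at some point of \<open>C\<close>, where \<open>f\<close> exceeds \<open>h\<close>.\<close>

lemma exact_penalty:
  fixes f :: "'a::metric_space \<Rightarrow> ereal"
  assumes f: "lsc f" and h: "continuous_on UNIV h" and C: "compact C" "C \<noteq> {}"
    and S: "\<And>z. z \<in> S \<Longrightarrow> ereal m \<le> f z"
    and hS: "\<And>z. z \<in> S \<Longrightarrow> h z \<le> M"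
    and above: "\<And>q. q \<in> C \<Longrightarrow> ereal (h q) < f q"
  obtains K where "K \<ge> 0" "\<And>z. z \<in> S \<Longrightarrow> ereal (h z - K * infdist z C) \<le> f z"
proof -
  have "\<exists>n::nat. \<forall>z\<in>S. ereal (h z - real n * infdist z C) \<le> f z"
  proof (rule ccontr)
    assume "\<not> ?thesis"
    then obtain z where z: "\<And>n. z n \<in> S" "\<And>n. f (z n) < ereal (h (z n) - real n * infdist (z n) C)"
      by (metis not_le)
    have bound: "real n * infdist (z n) C \<le> M - m" for n
    proof -
      have "ereal m < ereal (h (z n) - real n * infdist (z n) C)"
        using S[OF z(1)[of n]] z(2)[of n] by (rule le_less_trans)
      then show ?thesis using hS[OF z(1)[of n]] by simp
    qed
    have "(\<lambda>n. infdist (z n) C) \<longlonglongrightarrow> 0"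
    proof (rule tendsto_sandwich[OF _ _ tendsto_const])
      show "\<forall>\<^sub>F n in sequentially. 0 \<le> infdist (z n) C" by (simp add: infdist_nonneg)
      show "\<forall>\<^sub>F n in sequentially. infdist (z n) C \<le> (M - m) / real n"
        using eventually_gt_at_top[of 0] by eventually_elim (use bound in \<open>simp add: field_simps\<close>)
      show "(\<lambda>n. (M - m) / real n) \<longlonglongrightarrow> 0" by (rule lim_const_over_n)
    qed
    moreover have "\<forall>n. \<exists>q. q \<in> C \<and> infdist (z n) C = dist (z n) q"
      using infdist_attained[OF C] by blast
    then obtain q where q: "\<And>n. q n \<in> C" "\<And>n. infdist (z n) C = dist (z n) (q n)"
      by metis
    ultimately have dist0: "(\<lambda>n. dist (z n) (q n)) \<longlonglongrightarrow> 0" by simp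
    obtain p r where p: "p \<in> C" and r: "strict_mono (r :: nat \<Rightarrow> nat)" and lim: "(q \<circ> r) \<longlonglongrightarrow> p"
      using C(1) q(1) unfolding compact_def by metis
    have "(\<lambda>n. dist (z (r n)) (q (r n))) \<longlonglongrightarrow> 0"
      using LIMSEQ_subseq_LIMSEQ[OF dist0 r] by (simp add: o_def)
    moreover have "(\<lambda>n. dist (q (r n)) p) \<longlonglongrightarrow> 0"
      using lim by (simp add: o_def flip: tendsto_dist_iff)
    ultimately have "(\<lambda>n. dist (z (r n)) (q (r n)) + dist (q (r n)) p) \<longlonglongrightarrow> 0"
      using tendsto_add[of _ 0 _ _ 0] by fastforce
    then have "(\<lambda>n. dist (z (r n)) p) \<longlonglongrightarrow> 0"
      by (rule tendsto_sandwich[OF _ _ tendsto_const, rotated 2]) (simp_all add: dist_triangle)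
    then have "(\<lambda>n. z (r n)) \<longlonglongrightarrow> p"
      by (simp flip: tendsto_dist_iff)
    moreover have "z (r n) \<in> {w. f w \<le> ereal (h w)}" for n
    proof -
      have "f (z (r n)) \<le> ereal (h (z (r n)) - real (r n) * infdist (z (r n)) C)"
        using z(2) by (simp add: less_imp_le)
      also have "\<dots> \<le> ereal (h (z (r n)))" by (simp add: infdist_nonneg)
      finally show ?thesis by simp
    qed
    ultimately have "p \<in> {w. f w \<le> ereal (h w)}"
      using closed_lsc_le_continuous[OF f h] by (meson closed_sequentially)
    then show False using above[OF p] by simp
  qed
  then show ?thesis using that of_nat_0_le_iff by blast
qed

text \<open>A strict lower bound survives the passage from a weak* limit to the approximating subgradients:
  replacing \<open>z\<close> by \<open>x\<close> inside the argument costs \<open>\<alpha> x'(x - z)\<close>, whose upper limit is at most \<open>0\<close>.\<close>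

lemma subdiff_closure_approx:
  assumes z': "z' \<in> subdiff_closure A f z" and eps: "\<epsilon> > 0" and \<alpha>: "\<alpha> \<ge> 0"
    and lam: "c < blinfun_apply z' (v + \<alpha> *\<^sub>R (a - z))"
  shows "\<exists>x x'. x' \<in> A x \<and> dist x z < \<epsilon> \<and> c < blinfun_apply x' (v + \<alpha> *\<^sub>R (a - x))"
proof -
  obtain F where F: "F \<noteq> bot" "\<forall>\<^sub>F (x, x') in F. x' \<in> A x" "((\<lambda>(x, x'). x) \<longlongrightarrow> z) F"
    "\<And>h. ((\<lambda>(x, x'). blinfun_apply x' h) \<longlongrightarrow> blinfun_apply z' h) F"
    "Limsup F (\<lambda>(x, x'). ereal (blinfun_apply x' (x - z))) \<le> 0"
    using z' unfolding subdiff_closure_def by blast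
  define w where "w = v + \<alpha> *\<^sub>R (a - z)"
  define \<kappa> where "\<kappa> = (blinfun_apply z' w - c) / 2 / (\<alpha> + 1)"
  have \<kappa>: "\<kappa> > 0" using lam \<alpha> by (simp add: \<kappa>_def w_def)
  have \<kappa>2: "\<kappa> + \<alpha> * \<kappa> < blinfun_apply z' w - c"
  proof -
    have "\<kappa> + \<alpha> * \<kappa> = (\<alpha> + 1) * \<kappa>" by (simp add: algebra_simps)
    also have "\<dots> = (blinfun_apply z' w - c) / 2"
      using \<alpha> unfolding \<kappa>_def by (subst times_divide_eq_right, subst nonzero_mult_div_cancel_left) auto
    finally have "\<kappa> + \<alpha> * \<kappa> = (blinfun_apply z' w - c) / 2" .
    then show ?thesis using lam by (simp add: w_def)
  qed
  have 1: "\<forall>\<^sub>F (x, x') in F. dist x z < \<epsilon>"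
    using tendstoD[OF F(3) eps] by (simp add: case_prod_unfold)
  have 2: "\<forall>\<^sub>F (x, x') in F. blinfun_apply z' w - \<kappa> < blinfun_apply x' w"
    using order_tendstoD(1)[OF F(4)[of w], of "blinfun_apply z' w - \<kappa>"] \<kappa>
    by (simp add: case_prod_unfold)
  have "Limsup F (\<lambda>(x, x'). ereal (blinfun_apply x' (x - z))) < ereal \<kappa>"
    using F(5) \<kappa> by (metis ereal_less(2) le_less_trans)
  then have 3: "\<forall>\<^sub>F (x, x') in F. blinfun_apply x' (x - z) < \<kappa>"
    using Limsup_lessD[of F "\<lambda>(x, x'). ereal (blinfun_apply x' (x - z))" "ereal \<kappa>"]
    by (simp add: case_prod_unfold)
  obtain x x' where x: "x' \<in> A x" "dist x z < \<epsilon>" "blinfun_apply z' w - \<kappa> < blinfun_apply x' w"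
     "blinfun_apply x' (x - z) < \<kappa>"
    using eventually_happens'[OF F(1) eventually_conj[OF eventually_conj[OF F(2) 1] eventually_conj[OF 2 3]]]
    by auto
  have "v + \<alpha> *\<^sub>R (a - x) = w - \<alpha> *\<^sub>R (x - z)" by (simp add: w_def algebra_simps)
  then have "blinfun_apply x' (v + \<alpha> *\<^sub>R (a - x)) = blinfun_apply x' w - \<alpha> * blinfun_apply x' (x - z)"
    by (simp add: blinfun.diff_right blinfun.scaleR_right)
  moreover have "\<alpha> * blinfun_apply x' (x - z) \<le> \<alpha> * \<kappa>"
    using x(4) \<alpha> by (simp add: mult_left_mono)
  ultimately have "c < blinfun_apply x' (v + \<alpha> *\<^sub>R (a - x))" using x(3) \<kappa>2 by linarith
  then show ?thesis using x by blast
qed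

text \<open>The segment \<open>C\<close> from \<open>a\<close> in the direction \<open>v\<close> is short enough for \<open>f (a + s v) \<ge> f a + b s\<close> to hold
  on it, where \<open>c < b = l v\<close>. The minimum of \<open>f\<close> plus the convex function
  \<open>k = K infdist _ C - l (_ - a) + \<rho> dist z\<close> at a point \<open>z\<close> close to \<open>a\<close> gives \<open>x'\<close> with
  \<open>x' u \<ge> k z - k (z + u)\<close>. The large constant \<open>K\<close> is harmless for the two displacements \<open>u\<close> that matter,
  since neither increases the distance to \<open>C\<close>: a multiple of \<open>v\<close>, which gives \<open>x' v \<ge> b - \<rho> |v|\<close>, and
  \<open>a - z\<close>, which shows that \<open>x'(a - z)\<close> is almost nonnegative.\<close>

lemma subgradient_beyond_radial_subderiv:
  fixes D :: "('a::banach \<Rightarrow> ereal) \<Rightarrow> 'a \<Rightarrow> ('a \<Rightarrow>\<^sub>L real) set"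
  assumes D: "subdifferential D" and f: "lsc_proper f" and v: "v \<noteq> 0"
    and c: "ereal c < radial_subderiv f a v" and \<epsilon>: "\<epsilon> > 0" and \<alpha>: "\<alpha> \<ge> 0"
  shows "\<exists>x x'. x' \<in> D f x \<and> dist x a < \<epsilon> \<and> c < blinfun_apply x' (v + \<alpha> *\<^sub>R (a - x))"
proof -
  have a: "a \<in> edom f" using c by (auto simp: radial_subderiv_def split: if_splits)
  obtain fa where fa: "f a = ereal fa"
    using a f by (cases "f a") (auto simp: edom_def lsc_proper_def proper_def)
  have lsc: "lsc f" using f by (simp add: lsc_proper_def)
  obtain b where b: "c < b" "ereal b < radial_subderiv f a v"
    using c ereal_dense2 by (metis less_ereal.simps(1))
  have "\<forall>\<^sub>F t in at_right (0::real). ereal b < (f (a + t *\<^sub>R v) - f a) / ereal t"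
    using b(2) a less_LiminfD by (auto simp: radial_subderiv_def)
  then obtain t0 where t0: "t0 > 0"
    "\<And>t. 0 < t \<Longrightarrow> t < t0 \<Longrightarrow> ereal b < (f (a + t *\<^sub>R v) - f a) / ereal t"
    by (auto simp: eventually_at_right_field)
  have ray: "ereal (fa + b * t) < f (a + t *\<^sub>R v)" if "0 < t" "t < t0" for t
    using t0(2)[OF that] that(1) by (cases "f (a + t *\<^sub>R v)") (auto simp: fa field_simps)
  obtain l :: "'a \<Rightarrow>\<^sub>L real" where l: "blinfun_apply l v = b"
    using exists_functional_with_value[OF D v] .
  have "ereal (fa - 1) < f a" by (simp add: fa)
  from lsc_eventually_gt[OF lsc this] obtain r0 where r0: "r0 > 0"
    "\<And>x. dist x a < r0 \<Longrightarrow> ereal (fa - 1) < f x"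
    unfolding eventually_nhds_metric by blast
  define r where "r = r0 / 2"
  have r: "r > 0" "\<And>x. x \<in> cball a r \<Longrightarrow> ereal (fa - 1) \<le> f x"
    using r0 by (auto simp: r_def dist_commute intro!: less_imp_le)
  define t where "t = t0 / 2"
  have t: "0 < t" "t < t0" using t0(1) by (simp_all add: t_def)
  define C where "C = closed_segment a (a + t *\<^sub>R v)"
  have C: "compact C" "convex C" "C \<noteq> {}" "a \<in> C" by (auto simp: C_def)
  have C_iff: "x \<in> C \<longleftrightarrow> (\<exists>s. 0 \<le> s \<and> s \<le> t \<and> x = a + s *\<^sub>R v)" for x
  proof -
    have "x \<in> C \<longleftrightarrow> (\<exists>u. 0 \<le> u \<and> u \<le> 1 \<and> x = a + (u * t) *\<^sub>R v)"
      by (auto simp: C_def in_segment algebra_simps)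
    also have "\<dots> \<longleftrightarrow> (\<exists>s. 0 \<le> s \<and> s \<le> t \<and> x = a + s *\<^sub>R v)"
    proof safe
      fix u :: real assume "0 \<le> u" "u \<le> 1"
      then show "\<exists>s. 0 \<le> s \<and> s \<le> t \<and> a + (u * t) *\<^sub>R v = a + s *\<^sub>R v"
        using t by (intro exI[of _ "u * t"]) (auto simp: mult_left_le_one_le)
    next
      fix s assume "0 \<le> s" "s \<le> t"
      then show "\<exists>u\<ge>0. u \<le> 1 \<and> a + s *\<^sub>R v = a + (u * t) *\<^sub>R v"
        using t by (intro exI[of _ "s / t"]) auto
    qed
    finally show ?thesis .
  qed
  have fC: "ereal (fa + b * s) \<le> f (a + s *\<^sub>R v)" if "0 \<le> s" "s \<le> t" for s
    using that ray[of s] t by (cases "s = 0") (auto simp: fa less_imp_le)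
  define N where "N = norm v + \<alpha> * (norm l + 1)"
  have N: "N > 0" using v \<alpha> by (simp add: N_def add_pos_nonneg)
  \<comment> \<open>With \<open>\<rho>\<close> the Ekeland constant, \<open>z\<close> is at distance at most \<open>\<rho>\<close> from \<open>a\<close>: \<open>\<rho> < r\<close> keeps it interior to
    the ball, \<open>2 \<rho> < t |v|\<close> keeps its projection to \<open>C\<close> away from the far end, and \<open>\<rho> N < b - c\<close> pays
    for all error terms.\<close>
  have "\<exists>\<rho>>0. \<rho> < 1 \<and> \<rho> < r \<and> \<rho> < \<epsilon> \<and> 2 * \<rho> < t * norm v \<and> \<rho> < (b - c) / N"
  proof -
    have "Min {1, r, \<epsilon>, t * norm v / 2, (b - c) / N} > 0"
      using r \<epsilon> t v b N by (subst Min_gr_iff) auto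
    then obtain \<rho> where "0 < \<rho>" "\<rho> < Min {1, r, \<epsilon>, t * norm v / 2, (b - c) / N}"
      using dense by blast
    then show ?thesis by (intro exI[of _ \<rho>]) auto
  qed
  then obtain \<rho> where \<rho>: "\<rho> > 0" "\<rho> < 1" "\<rho> < r" "\<rho> < \<epsilon>" "2 * \<rho> < t * norm v" "\<rho> * N < b - c"
    using N by (auto simp: field_simps)
  define h where "h x = fa - \<rho> * \<rho> + blinfun_apply l (x - a)" for x
  have h_cont: "continuous_on UNIV h" unfolding h_def by (intro continuous_intros)
  obtain K where K: "K \<ge> 0" "\<And>x. x \<in> cball a r \<Longrightarrow> ereal (h x - K * infdist x C) \<le> f x"
  proof (rule exact_penalty[OF lsc h_cont C(1,3)])
    show "ereal (fa - 1) \<le> f z" if "z \<in> cball a r" for z using r(2) that .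
    show "h z \<le> fa + norm l * r" if "z \<in> cball a r" for z
    proof -
      have "blinfun_apply l (z - a) \<le> norm l * norm (z - a)"
        using norm_blinfun[of l "z - a"] by simp
      also have "\<dots> \<le> norm l * r"
        using that by (intro mult_left_mono) (auto simp: dist_norm norm_minus_commute)
      finally show ?thesis using mult_pos_pos[OF \<rho>(1) \<rho>(1)] unfolding h_def by linarith
    qed
    show "ereal (h q) < f q" if qC: "q \<in> C" for q
    proof -
      obtain s where s: "0 \<le> s" "s \<le> t" "q = a + s *\<^sub>R v" using qC C_iff by blast
      have "ereal (h q) < ereal (fa + b * s)"
        using \<rho>(1) by (simp add: h_def s blinfun.scaleR_right l)
      then show ?thesis using fC[OF s(1,2)] s(3) by (metis less_le_trans)
    qed
  qed (use that in blast)
  let ?pen = "\<lambda>x. K * infdist x C - blinfun_apply l (x - a)"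
  \<comment> \<open>By the choice of \<open>K\<close>, \<open>f\<close> plus the penalty term is at least \<open>fa - \<rho>\<^sup>2\<close> on the ball, so \<open>a\<close> minimises it up to
    \<open>\<rho>\<^sup>2\<close>. On \<open>S\<close> it is real-valued; elsewhere in the ball it exceeds its value at \<open>a\<close>.\<close>
  define G where "G x = real_of_ereal (f x) + ?pen x" for x
  define S where "S = {x \<in> cball a r. f x \<le> ereal (fa - ?pen x)}"
  have f_fin: "f x = ereal (real_of_ereal (f x))" if "x \<in> S" for x
    using that r(2)[of x] by (cases "f x") (auto simp: S_def)
  have aS: "a \<in> S" using r C(4) by (simp add: S_def fa)
  have "\<exists>z\<in>S. dist z a \<le> \<rho> \<and> (\<forall>w\<in>S. G z \<le> G w + \<rho> * dist w z)"
  proof (rule ekeland)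
    show "closed {w \<in> S. G w + \<rho> * dist w x \<le> d}" if "x \<in> S" for x d
    proof -
      have "{w \<in> S. G w + \<rho> * dist w x \<le> d} = cball a r \<inter> {w. f w \<le> ereal (fa - ?pen w)} \<inter>
          {w. f w \<le> ereal (d - ?pen w - \<rho> * dist w x)}"
      proof safe
        fix w assume "w \<in> S" "G w + \<rho> * dist w x \<le> d"
        then show "f w \<le> ereal (d - ?pen w - \<rho> * dist w x)"
          by (subst f_fin) (auto simp: G_def)
      next
        fix w assume w: "w \<in> cball a r" "f w \<le> ereal (fa - ?pen w)"
          and le: "f w \<le> ereal (d - ?pen w - \<rho> * dist w x)"
        show S: "w \<in> S" using w by (simp add: S_def)
        show "G w + \<rho> * dist w x \<le> d" using le by (subst (asm) f_fin[OF S]) (simp add: G_def)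
      qed (auto simp: S_def)
      moreover have "closed (cball a r \<inter> {w. f w \<le> ereal (fa - ?pen w)} \<inter>
          {w. f w \<le> ereal (d - ?pen w - \<rho> * dist w x)})"
        by (intro closed_Int closed_cball closed_lsc_le_continuous lsc continuous_intros)
      ultimately show ?thesis by simp
    qed
    show "fa - \<rho> * \<rho> \<le> G w" if "w \<in> S" for w
    proof -
      have "ereal (h w - K * infdist w C) \<le> ereal (real_of_ereal (f w))"
        using K(2)[of w] that f_fin[OF that] by (simp add: S_def)
      then show ?thesis by (simp add: G_def h_def)
    qed
    show "G a \<le> fa - \<rho> * \<rho> + \<rho> * \<rho>" using C(4) by (simp add: G_def fa)
  qed (use aS \<rho> in auto)
  then obtain z where zS: "z \<in> S" and za: "dist z a \<le> \<rho>"
    and zmin: "\<And>w. w \<in> S \<Longrightarrow> G z \<le> G w + \<rho> * dist w z" by blast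
  define k where "k x = ?pen x + \<rho> * dist z x" for x
  have zk: "f z + ereal (k z) = ereal (G z)"
    by (subst f_fin[OF zS]) (simp add: G_def k_def)
  have Gz: "G z \<le> fa"
  proof -
    have "ereal (real_of_ereal (f z)) \<le> ereal (fa - ?pen z)"
      using zS f_fin[OF zS] by (simp add: S_def)
    then show ?thesis by (simp add: G_def)
  qed
  have locmin: "\<forall>\<^sub>F x in nhds z. f z + ereal (k z) \<le> f x + ereal (k x)"
  proof -
    have "\<forall>\<^sub>F x in nhds z. dist x z < r - \<rho>"
      using \<rho>(3) by (metis diff_gt_0_iff_gt eventually_nhds_metric)
    then show ?thesis
    proof eventually_elim
      case (elim x)
      have xr: "x \<in> cball a r"
        using elim za dist_triangle[of x a z] by (simp add: dist_commute)
      show ?case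
      proof (cases "x \<in> S")
        case True
        then have "f x + ereal (k x) = ereal (G x + \<rho> * dist x z)"
          by (subst f_fin) (auto simp: G_def k_def dist_commute)
        then show ?thesis using zmin[OF True] zk by simp
      next
        case False
        then have "ereal (fa - ?pen x) < f x" using xr by (simp add: S_def)
        then have "ereal fa \<le> f x + ereal (k x)"
          using mult_nonneg_nonneg[OF less_imp_le[OF \<rho>(1)] zero_le_dist[of z x]]
          by (cases "f x") (auto simp: k_def)
        then show ?thesis using Gz zk by (metis ereal_less_eq(3) order_trans)
      qed
    qed
  qed
  have k_conv: "convex_on UNIV k"
  proof -
    have "convex_on UNIV (\<lambda>x. - blinfun_apply l (x - a))"
      by (auto simp: convex_on_def blinfun.bilinear_simps algebra_simps simp flip: distrib_right)
    then have "convex_on UNIV (\<lambda>x. K * infdist x C + - blinfun_apply l (x - a) + \<rho> * dist z x)"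
      using K(1) \<rho>(1) C by (intro convex_on_add convex_on_cmul convex_on_dist convex_on_infdist) auto
    moreover have "k = (\<lambda>x. K * infdist x C + - blinfun_apply l (x - a) + \<rho> * dist z x)"
      by (auto simp: k_def)
    ultimately show ?thesis by simp
  qed
  have k_lip: "(K + norm l + \<rho>)-lipschitz_on UNIV k"
  proof (rule lipschitz_onI)
    fix x y
    have "\<bar>K * infdist x C - K * infdist y C\<bar> \<le> K * dist x y"
      using infdist_triangle_abs[of x C y] K(1) by (simp add: mult_left_mono abs_mult flip: right_diff_distrib)
    moreover have "\<bar>blinfun_apply l (x - a) - blinfun_apply l (y - a)\<bar> \<le> norm l * dist x y"
      using norm_blinfun[of l "x - y"] by (simp add: blinfun.diff_right dist_norm)
    moreover have "\<bar>\<rho> * dist z x - \<rho> * dist z y\<bar> \<le> \<rho> * dist x y"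
      using abs_dist_diff_le[of x z y] \<rho>(1)
      by (simp add: mult_left_mono abs_mult dist_commute flip: right_diff_distrib)
    ultimately show "dist (k x) (k y) \<le> (K + norm l + \<rho>) * dist x y"
      unfolding dist_real_def k_def by (simp add: distrib_right)
  qed (use K \<rho> in auto)
  have "z \<in> edom f" unfolding edom_def by (simp, subst f_fin[OF zS]) simp
  then obtain x' where x': "x' \<in> subdiff_closure (D f) f z"
    and sub: "\<And>u. k z - k (z + u) \<le> blinfun_apply x' u"
    using subdifferential_convex_sum_rule[OF D f _ k_conv k_lip locmin] by blast
  have along_v: "b - \<rho> * norm v \<le> blinfun_apply x' v"
  proof -
    \<comment> \<open>The projection \<open>q\<close> of \<open>z\<close> is close to \<open>a\<close>, so it can be moved along \<open>v\<close> within \<open>C\<close>; moving \<open>z\<close> in parallel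
      does not increase its distance to \<open>C\<close>.\<close>
    obtain q where q: "q \<in> C" "infdist z C = dist z q" using infdist_attained[OF C(1,3)] by blast
    obtain s where s: "0 \<le> s" "s \<le> t" "q = a + s *\<^sub>R v" using q(1) C_iff by blast
    have "dist z q \<le> \<rho>" using infdist_le[OF C(4), of z] za q(2) by simp
    then have "dist a q \<le> 2 * \<rho>" using za dist_triangle[of a q z] by (simp add: dist_commute)
    then have "s * norm v < t * norm v" using \<rho>(5) s by (simp add: dist_norm)
    then have "s < t" using v by simp
    define \<sigma> where "\<sigma> = t - s"
    have \<sigma>: "\<sigma> > 0" using \<open>s < t\<close> by (simp add: \<sigma>_def)
    have "q + \<sigma> *\<^sub>R v \<in> C"
      using s \<sigma> t by (auto simp: C_iff \<sigma>_def algebra_simps intro!: exI[of _ t])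
    then have "infdist (z + \<sigma> *\<^sub>R v) C \<le> infdist z C"
      using infdist_le[of "q + \<sigma> *\<^sub>R v" C "z + \<sigma> *\<^sub>R v"] q(2) by simp
    then have "K * infdist (z + \<sigma> *\<^sub>R v) C \<le> K * infdist z C" using K(1) by (rule mult_left_mono)
    then have "\<sigma> * b - \<rho> * (\<sigma> * norm v) \<le> k z - k (z + \<sigma> *\<^sub>R v)"
      using \<sigma> by (simp add: k_def dist_norm blinfun.bilinear_simps l)
    also have "\<dots> \<le> \<sigma> * blinfun_apply x' v"
      using sub[of "\<sigma> *\<^sub>R v"] by (simp add: blinfun.scaleR_right)
    finally have "\<sigma> * (b - \<rho> * norm v) \<le> \<sigma> * blinfun_apply x' v" by (simp add: algebra_simps)
    then show ?thesis using \<sigma> by simp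
  qed
  have towards_a: "- ((norm l + 1) * \<rho>) \<le> blinfun_apply x' (a - z)"
  proof -
    have "k a \<le> \<rho>"
      using za C(4) \<rho> mult_mono[of \<rho> 1 "dist z a" \<rho>] by (simp add: k_def)
    moreover have "- (norm l * \<rho>) \<le> k z"
    proof -
      have "blinfun_apply l (z - a) \<le> norm l * norm (z - a)"
        using norm_blinfun[of l "z - a"] by simp
      also have "\<dots> \<le> norm l * \<rho>" using za by (intro mult_left_mono) (auto simp: dist_norm)
      finally show ?thesis using mult_nonneg_nonneg[OF K(1) infdist_nonneg[of z C]] \<rho>(1)
        by (simp add: k_def)
    qed
    ultimately show ?thesis using sub[of "a - z"] by (simp add: algebra_simps)
  qed
  have beyond: "c < blinfun_apply x' (v + \<alpha> *\<^sub>R (a - z))"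
  proof -
    have "\<alpha> * - ((norm l + 1) * \<rho>) \<le> \<alpha> * blinfun_apply x' (a - z)"
      using towards_a \<alpha> by (rule mult_left_mono)
    moreover have "\<rho> * N = \<rho> * norm v + \<alpha> * ((norm l + 1) * \<rho>)" by (simp add: N_def algebra_simps)
    moreover have "blinfun_apply x' (v + \<alpha> *\<^sub>R (a - z)) = blinfun_apply x' v + \<alpha> * blinfun_apply x' (a - z)"
      by (simp add: blinfun.add_right blinfun.scaleR_right)
    ultimately show ?thesis using along_v \<rho>(6) by linarith
  qed
  have "\<epsilon> - \<rho> > 0" using \<rho>(4) by simp
  from subdiff_closure_approx[OF x' this \<alpha> beyond]
  obtain x y' where y': "y' \<in> D f x" "dist x z < \<epsilon> - \<rho>"
     "c < blinfun_apply y' (v + \<alpha> *\<^sub>R (a - x))"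
    by blast
  moreover have "dist x a < \<epsilon>" using y'(2) za dist_triangle[of x a z] by simp
  ultimately show ?thesis by blast
qed

section \<open>One slope for all sequences\<close>

lemma countable_cofinal_subset:
  fixes A :: "real set"
  shows "\<exists>C. countable C \<and> C \<subseteq> A \<and> (\<forall>a\<in>A. \<exists>c\<in>C. a \<le> c)"
proof -
  define Q where "Q = {q \<in> \<rat>. \<exists>a\<in>A. q \<le> a}"
  define above where "above q = (SOME a. a \<in> A \<and> q \<le> a)" for q
  have above: "above q \<in> A" "q \<le> above q" if "q \<in> Q" for q
    using that someI_ex[of "\<lambda>a. a \<in> A \<and> q \<le> a"] by (auto simp: Q_def above_def)
  define M where "M = {a \<in> A. \<forall>b\<in>A. b \<le> a}"
  have "countable M"
  proof -
    have "a = b" if "a \<in> M" "b \<in> M" for a b using that by (auto simp: M_def intro: antisym)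
    then have "M = {} \<or> (\<exists>a. M = {a})" by blast
    then show ?thesis by auto
  qed
  then have "countable (above ` Q \<union> M)"
    using countable_rat by (auto simp: Q_def intro: countable_subset[of _ \<rat>])
  moreover have "\<exists>c\<in>above ` Q \<union> M. a \<le> c" if "a \<in> A" for a
  proof (cases "a \<in> M")
    case False
    then obtain b where b: "b \<in> A" "a < b" using \<open>a \<in> A\<close> by (auto simp: M_def not_le)
    then obtain q where "q \<in> \<rat>" "a < q" "q < b" using Rats_dense_in_real by blast
    then have "q \<in> Q" using b by (auto simp: Q_def intro: less_imp_le)
    moreover from this have "a \<le> above q" using above(2)[of q] \<open>a < q\<close> by simp
    ultimately show ?thesis by blast
  qed auto
  moreover have "above ` Q \<union> M \<subseteq> A" using above by (auto simp: M_def)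
  ultimately show ?thesis by blast
qed

text \<open>Contrapositive form of the passage from a slope for each sequence to one slope for all: if every
  slope \<open>\<alpha>\<close> is violated by points arbitrarily far along \<open>near\<close>, then a single sequence violates every
  slope infinitely often. \<open>Down\<close> collects the slopes violated by points with \<open>B p \<le> 0\<close>, which violate
  all smaller slopes too; \<open>Up\<close> those violated by points with \<open>B p \<ge> 0\<close>, which violate all larger ones.
  So a countable cofinal part of \<open>Down\<close> and a countable coinitial part of \<open>Up\<close> take care of all
  slopes, and \<open>prod_decode\<close> serves to visit each of their members infinitely often.\<close>

lemma uniform_slope:
  fixes near :: "nat \<Rightarrow> 'p \<Rightarrow> bool" and A B :: "'p \<Rightarrow> real"
  assumes frequently: "\<And>\<alpha> k. \<alpha> \<ge> 0 \<Longrightarrow> \<exists>p. near k p \<and> c < A p + \<alpha> * B p"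
    and antimono: "\<And>j k p. j \<le> k \<Longrightarrow> near k p \<Longrightarrow> near j p"
  shows "\<exists>p. (\<forall>k. near k (p k)) \<and> (\<forall>\<beta>\<ge>0. \<exists>\<^sub>\<infinity>k. c < A (p k) + \<beta> * B (p k))"
proof -
  define Down where "Down = {\<alpha>. \<alpha> \<ge> 0 \<and> (\<forall>k. \<exists>p. near k p \<and> c < A p + \<alpha> * B p \<and> B p \<le> 0)}"
  define Up where "Up = {\<alpha>. \<alpha> \<ge> 0 \<and> (\<forall>k. \<exists>p. near k p \<and> c < A p + \<alpha> * B p \<and> B p \<ge> 0)}"
  have cover: "\<beta> \<in> Down \<or> \<beta> \<in> Up" if "\<beta> \<ge> 0" for \<beta>
  proof (rule ccontr)
    assume contra: "\<not> (\<beta> \<in> Down \<or> \<beta> \<in> Up)"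
    then obtain i where i: "\<And>p. near i p \<Longrightarrow> c < A p + \<beta> * B p \<Longrightarrow> \<not> B p \<le> 0"
      using \<open>\<beta> \<ge> 0\<close> unfolding Down_def by auto
    obtain j where j: "\<And>p. near j p \<Longrightarrow> c < A p + \<beta> * B p \<Longrightarrow> \<not> B p \<ge> 0"
      using contra \<open>\<beta> \<ge> 0\<close> unfolding Up_def by auto
    obtain p where p: "near (max i j) p" "c < A p + \<beta> * B p" using frequently \<open>\<beta> \<ge> 0\<close> by blast
    have "near i p" "near j p" using antimono[OF _ p(1)] by simp_all
    with i[OF _ p(2)] j[OF _ p(2)] show False by simp
  qed
  obtain C1 where C1: "countable C1" "C1 \<subseteq> Down" "\<And>a. a \<in> Down \<Longrightarrow> \<exists>d\<in>C1. a \<le> d"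
    using countable_cofinal_subset[of Down] by blast
  obtain C2' where "countable C2' \<and> C2' \<subseteq> uminus ` Up \<and> (\<forall>a\<in>uminus ` Up. \<exists>d\<in>C2'. a \<le> d)"
    using countable_cofinal_subset[of "uminus ` Up"] by (rule exE)
  then have C2': "countable C2'" "C2' \<subseteq> uminus ` Up" "\<And>a. a \<in> Up \<Longrightarrow> \<exists>d\<in>C2'. - a \<le> d"
    by simp_all
  define covers where "covers j \<beta> = (if fst j then \<beta> \<le> snd j else snd j \<le> \<beta>)" for j :: "bool \<times> real" and \<beta>
  define J where "J = Pair True ` C1 \<union> (\<lambda>d. (False, - d)) ` C2'"
  have "countable J" using C1 C2' by (simp add: J_def)
  have J_bad: "\<exists>p. near k p \<and> (\<forall>\<beta>. covers j \<beta> \<longrightarrow> c < A p + \<beta> * B p)" if jJ: "j \<in> J" for j k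
  proof -
    have "(\<exists>d. j = (True, d) \<and> d \<in> Down) \<or> (\<exists>d. j = (False, d) \<and> d \<in> Up)"
      using jJ C1(2) C2'(2) by (auto simp: J_def)
    then consider d where "j = (True, d)" "d \<in> Down" | d where "j = (False, d)" "d \<in> Up"
      by blast
    then show ?thesis
    proof cases
      case (1 d)
      then obtain p where p: "near k p" "c < A p + d * B p" "B p \<le> 0" unfolding Down_def by blast
      have "c < A p + \<beta> * B p" if "\<beta> \<le> d" for \<beta>
        using mult_right_mono_neg[OF that p(3)] p(2) by linarith
      then show ?thesis using p(1) 1(1) by (auto simp: covers_def)
    next
      case (2 d)
      then obtain p where p: "near k p" "c < A p + d * B p" "0 \<le> B p" unfolding Up_def by blast
      have "c < A p + \<beta> * B p" if "d \<le> \<beta>" for \<beta>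
        using mult_right_mono[OF that p(3)] p(2) by linarith
      then show ?thesis using p(1) 2(1) by (auto simp: covers_def)
    qed
  qed
  have J_hit: "\<exists>j\<in>J. covers j \<beta>" if "\<beta> \<ge> 0" for \<beta>
    using cover[OF that]
  proof
    assume "\<beta> \<in> Down"
    then obtain d where "d \<in> C1" "\<beta> \<le> d" using C1 by blast
    then show ?thesis by (intro bexI[of _ "(True, d)"]) (auto simp: J_def covers_def)
  next
    assume "\<beta> \<in> Up"
    then obtain d where "d \<in> C2'" "- \<beta> \<le> d" using C2'(3)[of \<beta>] by blast
    then show ?thesis by (intro bexI[of _ "(False, - d)"]) (auto simp: J_def covers_def)
  qed
  have "J \<noteq> {}" using J_hit[of 0] by auto
  define visit where "visit k = from_nat_into J (fst (prod_decode k))" for k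
  have "\<exists>p. near k p \<and> (\<forall>\<beta>. covers (visit k) \<beta> \<longrightarrow> c < A p + \<beta> * B p)" for k
    by (rule J_bad) (simp add: visit_def from_nat_into \<open>J \<noteq> {}\<close>)
  then have "\<exists>p. \<forall>k. near k (p k) \<and> (\<forall>\<beta>. covers (visit k) \<beta> \<longrightarrow> c < A (p k) + \<beta> * B (p k))"
    by (intro choice) blast
  then obtain p where p: "\<And>k. near k (p k)"
    "\<And>k \<beta>. covers (visit k) \<beta> \<Longrightarrow> c < A (p k) + \<beta> * B (p k)"
    by blast
  have "\<exists>\<^sub>\<infinity>k. c < A (p k) + \<beta> * B (p k)" if "\<beta> \<ge> 0" for \<beta>
    unfolding INFM_nat_le
  proof
    fix n
    obtain j where j: "j \<in> J" "covers j \<beta>" using J_hit[OF \<open>\<beta> \<ge> 0\<close>] by blast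
    obtain i where i: "from_nat_into J i = j" using from_nat_into_surj[OF \<open>countable J\<close> j(1)] by blast
    have "visit (prod_encode (i, n)) = j" using i by (simp add: visit_def)
    then show "\<exists>k\<ge>n. c < A (p k) + \<beta> * B (p k)"
      using p(2) j(2) le_prod_encode_2[of n i] by blast
  qed
  then show ?thesis using p(1) by blast
qed

section \<open>Comparison of the subderivatives\<close>

lemma radial_subderiv_le_natnat: "radial_subderiv f x u \<le> natnat_subderiv f x u"
  unfolding natnat_subderiv_def
proof (rule INF_greatest)
  fix \<alpha> :: real
  let ?F = "\<lambda>y. radial_subderiv f y (u + \<alpha> *\<^sub>R (x - y))"
  have "?F x \<le> Limsup (nhds x) ?F"
    unfolding Limsup_def by (rule INF_greatest) (auto intro!: SUP_upper2[of x] dest: eventually_nhds_x_imp_x)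
  then show "radial_subderiv f x u \<le> Limsup (nhds x) ?F" by simp
qed

lemma at_direction_le_nhds: "at_direction x v \<le> nhds x"
proof -
  have "((\<lambda>p. x + fst p *\<^sub>R snd p) \<longlongrightarrow> x + 0 *\<^sub>R v) (at_right 0 \<times>\<^sub>F nhds v)"
    by (intro tendsto_intros filterlim_fst filterlim_compose[OF _ filterlim_fst]
          filterlim_compose[OF _ filterlim_snd] filterlim_snd tendsto_ident_at) 
  then show ?thesis by (simp add: at_direction_def filterlim_def case_prod_unfold)
qed

lemma Limsup_filter_mono: "F \<le> G \<Longrightarrow> Limsup F f \<le> Limsup G f"
  unfolding Limsup_def by (rule INF_superset_mono) (auto dest: filter_leD)

lemma nat_le_natnat: "nat_subderiv f x u \<le> natnat_subderiv f x u"
  unfolding nat_subderiv_def natnat_subderiv_def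
  by (intro INF_mono' Limsup_filter_mono at_direction_le_nhds)

text \<open>A minimum of \<open>\<psi>\<close> on \<open>[r, q]\<close> can only be at \<open>q\<close>, because from each interior point the function
  goes further down to the right; then let \<open>r\<close> tend to \<open>p\<close>.\<close>

lemma le_of_frequently_descending:
  fixes \<psi> :: "real \<Rightarrow> real"
  assumes cont: "continuous_on {p..q} \<psi>" and "p \<le> q"
    and desc: "\<And>s. p < s \<Longrightarrow> s < q \<Longrightarrow> \<exists>s'. s < s' \<and> s' < q \<and> \<psi> s' < \<psi> s"
  shows "\<psi> q \<le> \<psi> p"
proof (cases "p = q")
  case False
  then have pq: "p < q" using \<open>p \<le> q\<close> by simp
  have interior: "\<psi> q \<le> \<psi> r" if r: "p < r" "r < q" for r
  proof -
    have "continuous_on {r..q} \<psi>" using cont r by (auto intro: continuous_on_subset)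
    then obtain m where m: "m \<in> {r..q}" "\<And>s. s \<in> {r..q} \<Longrightarrow> \<psi> m \<le> \<psi> s"
      using continuous_attains_inf[of "{r..q}" \<psi>] r by auto
    have "m = q"
    proof (rule ccontr)
      assume "m \<noteq> q"
      then obtain s' where "m < s'" "s' < q" "\<psi> s' < \<psi> m" using desc[of m] m(1) r by force
      then show False using m(2)[of s'] m(1) by simp
    qed
    then show ?thesis using m(2)[of r] r by simp
  qed
  have "(\<psi> \<longlongrightarrow> \<psi> p) (at_right p)"
    using cont pq continuous_on_Icc_at_rightD by blast
  moreover have "\<forall>\<^sub>F r in at_right p. \<psi> q \<le> \<psi> r"
    unfolding eventually_at_right_field using interior pq by blast
  ultimately show ?thesis by (intro tendsto_lowerbound[of \<psi> "\<psi> p" "at_right p"]) auto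
qed simp

text \<open>At the points \<open>x + s u\<close>, which tend to \<open>x\<close> in the direction \<open>u\<close>, the direction
  \<open>u + \<alpha> (x - (x + s u))\<close> is the multiple \<open>1 - \<alpha> s\<close> of \<open>u\<close>. If the upper limit were below \<open>b\<close>, which
  in turn is below the radial subderivative, then near \<open>x\<close> the function \<open>\<gamma> s - b s\<close> would descend
  from every \<open>s > 0\<close>; so \<open>\<gamma> q - \<gamma> 0 \<le> b q\<close> for small \<open>q\<close>, which contradicts the choice of \<open>b\<close>.\<close>

lemma radial_subderiv_le_nat:
  assumes "h > 0" and \<gamma>: "\<And>s. 0 \<le> s \<Longrightarrow> s \<le> h \<Longrightarrow> g (x + s *\<^sub>R u) = ereal (\<gamma> s)"
    and cont: "continuous_on {0..h} \<gamma>"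
  shows "radial_subderiv g x u \<le> nat_subderiv g x u"
  unfolding nat_subderiv_def
proof (rule INF_greatest, rule ccontr)
  fix \<alpha> :: real assume "\<alpha> \<in> {0..}"
  let ?R = "\<lambda>y. radial_subderiv g y (u + \<alpha> *\<^sub>R (x - y))"
  assume "\<not> radial_subderiv g x u \<le> Limsup (at_direction x u) ?R"
  then have "Limsup (at_direction x u) ?R < radial_subderiv g x u" by (simp add: not_le)
  from ereal_dense2[OF this] obtain b
    where b: "Limsup (at_direction x u) ?R < ereal b" "ereal b < radial_subderiv g x u" by blast
  from ereal_dense2[OF b(1)] obtain a
    where a: "Limsup (at_direction x u) ?R < ereal a" "a < b" by (metis less_ereal.simps(1))
  have "\<forall>\<^sub>F p in at_right 0 \<times>\<^sub>F nhds u. ?R (x + fst p *\<^sub>R snd p) < ereal a"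
    using Limsup_lessD[OF a(1)] by (simp add: at_direction_def eventually_filtermap case_prod_unfold)
  then obtain Pf Pg where P: "eventually Pf (at_right (0::real))" "eventually Pg (nhds u)"
    "\<And>s w. Pf s \<Longrightarrow> Pg w \<Longrightarrow> ?R (x + s *\<^sub>R w) < ereal a"
    unfolding eventually_prod_filter by auto
  have "Pg u" using P(2) by (rule eventually_nhds_x_imp_x)
  have 1: "\<forall>\<^sub>F s in at_right (0::real). ?R (x + s *\<^sub>R u) < ereal a"
    using P(1) by eventually_elim (rule P(3)[OF _ \<open>Pg u\<close>])
  have lim: "((\<lambda>s. 1 - \<alpha> * s) \<longlongrightarrow> 1 - \<alpha> * 0) (at_right 0)" "((\<lambda>s. b * (1 - \<alpha> * s)) \<longlongrightarrow> b * (1 - \<alpha> * 0)) (at_right 0)"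
    by (intro tendsto_intros)+
  have 2: "\<forall>\<^sub>F s in at_right 0. 0 < 1 - \<alpha> * s" "\<forall>\<^sub>F s in at_right 0. a < b * (1 - \<alpha> * s)"
    using order_tendstoD(1)[OF lim(1), of 0] order_tendstoD(1)[OF lim(2), of a] a(2) by simp_all
  from eventually_conj[OF 1 eventually_conj[OF 2]] obtain \<delta> where \<delta>: "\<delta> > 0"
    "\<And>s. 0 < s \<Longrightarrow> s < \<delta> \<Longrightarrow> ?R (x + s *\<^sub>R u) < ereal a \<and> 0 < 1 - \<alpha> * s \<and> a < b * (1 - \<alpha> * s)"
    unfolding eventually_at_right_field by blast
  have slope: "\<gamma> q - b * q \<le> \<gamma> 0 - b * 0" if q: "0 < q" "q < min \<delta> h" for q
  proof (rule le_of_frequently_descending[where \<psi> = "\<lambda>s. \<gamma> s - b * s"])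
    have "continuous_on {0..q} \<gamma>" using q by (intro continuous_on_subset[OF cont]) auto
    then show "continuous_on {0..q} (\<lambda>s. \<gamma> s - b * s)"
      by (rule continuous_on_diff) (intro continuous_on_mult continuous_on_const continuous_on_id)
    fix s assume s: "0 < s" "s < q"
    define \<kappa> where "\<kappa> = 1 - \<alpha> * s"
    have \<kappa>: "?R (x + s *\<^sub>R u) < ereal a" "0 < \<kappa>" "a < b * \<kappa>"
      using \<delta>(2)[of s] s q unfolding \<kappa>_def by auto
    have dir: "u + \<alpha> *\<^sub>R (x - (x + s *\<^sub>R u)) = \<kappa> *\<^sub>R u" by (simp add: \<kappa>_def algebra_simps)
    have gs: "g (x + s *\<^sub>R u) = ereal (\<gamma> s)" using \<gamma>[of s] s q by simp
    let ?Q = "\<lambda>t. (g (x + s *\<^sub>R u + t *\<^sub>R \<kappa> *\<^sub>R u) - g (x + s *\<^sub>R u)) / ereal t"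
    have "Liminf (at_right 0) ?Q < ereal a"
      using \<kappa>(1) unfolding dir by (simp add: radial_subderiv_def edom_def gs)
    then have "\<not> (\<forall>\<^sub>F t in at_right 0. ereal a \<le> ?Q t)"
      using Liminf_bounded[of "ereal a" ?Q] by (meson leD)
    then have "\<exists>\<^sub>F t in at_right 0. ?Q t < ereal a"
      by (simp only: frequently_def not_less not_False_eq_True)
    moreover have "\<forall>\<^sub>F t in at_right 0. 0 < t \<and> t < (q - s) / \<kappa>"
      unfolding eventually_at_right_field using s \<kappa> by (intro exI[of _ "(q - s) / \<kappa>"]) auto
    ultimately have "\<exists>\<^sub>F t in at_right 0. ?Q t < ereal a \<and> 0 < t \<and> t < (q - s) / \<kappa>"
      by (rule frequently_eventually_frequently)
    from frequently_ex[OF this] obtain t where t: "0 < t" "t < (q - s) / \<kappa>"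
"?Q t < ereal a"
      by blast
    have lt: "t * \<kappa> < q - s" using t(2) \<kappa>(2) by (simp add: field_simps)
    have pos: "0 < t * \<kappa>" using t(1) \<kappa>(2) by simp
    have eq: "x + s *\<^sub>R u + t *\<^sub>R \<kappa> *\<^sub>R u = x + (s + t * \<kappa>) *\<^sub>R u" by (simp add: algebra_simps)
    have "g (x + s *\<^sub>R u + t *\<^sub>R \<kappa> *\<^sub>R u) = ereal (\<gamma> (s + t * \<kappa>))"
      unfolding eq using \<gamma>[of "s + t * \<kappa>"] s lt pos q by simp
    then have "(\<gamma> (s + t * \<kappa>) - \<gamma> s) / t < a" using t(1,3) gs by simp
    then have "\<gamma> (s + t * \<kappa>) - \<gamma> s < a * t" using t(1) by (simp add: field_simps)
    also have "\<dots> < b * \<kappa> * t" using \<kappa>(3) t(1) by simp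
    finally have "\<gamma> (s + t * \<kappa>) - b * (s + t * \<kappa>) < \<gamma> s - b * s" by (simp add: algebra_simps)
    then show "\<exists>s'. s < s' \<and> s' < q \<and> \<gamma> s' - b * s' < \<gamma> s - b * s"
      using lt pos by (intro exI[of _ "s + t * \<kappa>"]) auto
  qed (use q in simp)
  have g0: "g x = ereal (\<gamma> 0)" using \<gamma>[of 0] \<open>h > 0\<close> by simp
  then have "ereal b < Liminf (at_right 0) (\<lambda>t. (g (x + t *\<^sub>R u) - g x) / ereal t)"
    using b(2) by (simp add: radial_subderiv_def edom_def)
  from less_LiminfD[OF this]
  obtain \<delta>' where \<delta>': "\<delta>' > 0" "\<And>t. 0 < t \<Longrightarrow> t < \<delta>' \<Longrightarrow> ereal b < (g (x + t *\<^sub>R u) - g x) / ereal t"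
    unfolding eventually_at_right_field by blast
  define q where "q = min \<delta>' (min \<delta> h) / 2"
  have q: "0 < q" "q < \<delta>'" "q < min \<delta> h" using \<delta> \<delta>' \<open>h > 0\<close> by (auto simp: q_def)
  have "ereal b < (ereal (\<gamma> q) - ereal (\<gamma> 0)) / ereal q"
    using \<delta>'(2)[OF q(1,2)] \<gamma>[of q] g0 q by simp
  then have "b * q < \<gamma> q - \<gamma> 0" using q(1) by (simp add: field_simps)
  then show False using slope[OF q(1,3)] by simp
qed

text \<open>With \<open>w = y + \<sigma> u\<close> one has \<open>w - x = \<sigma> (u + (1/\<sigma>) (y - x))\<close>, so the hypothesis says that each
  sequence of subgradients admits the slope \<open>\<alpha> = 1/\<sigma>\<close>. If the conclusion failed, the mean value
  inequality would yield subgradients at points near \<open>y\<close> violating each given slope, and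
  \<open>uniform_slope\<close> would combine them into a sequence without an admissible slope.\<close>

lemma natnat_subderiv_le_of_subgradient_bound:
  fixes D :: "('a::banach \<Rightarrow> ereal) \<Rightarrow> 'a \<Rightarrow> ('a \<Rightarrow>\<^sub>L real) set"
  assumes D: "subdifferential D" and f: "lsc_proper f" and u: "u \<noteq> 0" and \<tau>: "\<tau> > 0"
    and bound: "\<And>x x'. (\<And>k. x' k \<in> D f (x k)) \<Longrightarrow> x \<longlonglongrightarrow> y \<Longrightarrow>
      \<exists>w\<in>left_open_segment y (y + \<tau> *\<^sub>R u).
        limsup (\<lambda>k. ereal (blinfun_apply (x' k) (w - x k)))
          \<le> ereal (norm (w - y)) * (ereal (inverse (norm u)) * r + ereal \<mu>)"
  shows "natnat_subderiv f y u \<le> r + ereal (\<mu> * norm u)"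
proof (rule ccontr)
  assume "\<not> ?thesis"
  then obtain c where c: "r + ereal (\<mu> * norm u) < ereal c" "ereal c < natnat_subderiv f y u"
    using ereal_dense2 by (metis not_le)
  define near where "near k p \<longleftrightarrow> snd p \<in> D f (fst p) \<and> dist (fst p) y < 1 / Suc k"
    for k and p :: "'a \<times> ('a \<Rightarrow>\<^sub>L real)"
  have "\<exists>p. near k p \<and> c < blinfun_apply (snd p) u + \<alpha> * blinfun_apply (snd p) (y - fst p)"
    if \<alpha>: "\<alpha> \<ge> 0" for \<alpha> k
  proof -
    let ?R = "\<lambda>x. radial_subderiv f x (u + \<alpha> *\<^sub>R (y - x))"
    have "natnat_subderiv f y u \<le> Limsup (nhds y) ?R"
      unfolding natnat_subderiv_def by (rule INF_lower) (simp add: \<alpha>)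
    then have "\<not> (\<forall>\<^sub>F x in nhds y. ?R x \<le> ereal c)"
      using c(2) Limsup_bounded by (metis leD order_trans)
    then have "\<exists>\<^sub>F x in nhds y. ereal c < ?R x" by (simp add: frequently_def not_less)
    moreover have "\<forall>\<^sub>F x in nhds y. dist x y < 1 / Suc k / 2"
      unfolding eventually_nhds_metric by (rule exI[of _ "1 / Suc k / 2"]) simp
    moreover have "((\<lambda>x. u + \<alpha> *\<^sub>R (y - x)) \<longlongrightarrow> u + \<alpha> *\<^sub>R (y - y)) (nhds y)"
      by (intro tendsto_intros filterlim_ident)
    then have "\<forall>\<^sub>F x in nhds y. u + \<alpha> *\<^sub>R (y - x) \<noteq> 0"
      using tendsto_imp_eventually_ne[of _ u] u by simp
    ultimately have "\<exists>\<^sub>F x in nhds y. (ereal c < ?R x \<and> dist x y < 1 / Suc k / 2) \<and> u + \<alpha> *\<^sub>R (y - x) \<noteq> 0"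
      by (intro frequently_eventually_frequently)
    then obtain z where z: "ereal c < ?R z" "dist z y < 1 / Suc k / 2" "u + \<alpha> *\<^sub>R (y - z) \<noteq> 0"
      by (auto dest: frequently_ex)
    have "1 / Suc k / 2 > (0::real)" by simp
    from subgradient_beyond_radial_subderiv[OF D f z(3,1) this \<alpha>]
    obtain x x' where x: "x' \<in> D f x" "dist x z < 1 / Suc k / 2"
      "c < blinfun_apply x' (u + \<alpha> *\<^sub>R (y - z) + \<alpha> *\<^sub>R (z - x))" by blast
    have "dist x y < 1 / Suc k / 2 + 1 / Suc k / 2"
      using dist_triangle[of x y z] x(2) z(2) by linarith
    then have "dist x y < 1 / Suc k" by (simp only: field_sum_of_halves)
    moreover have eq: "u + \<alpha> *\<^sub>R (y - z) + \<alpha> *\<^sub>R (z - x) = u + \<alpha> *\<^sub>R (y - x)"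
      by (simp add: algebra_simps)
    have "c < blinfun_apply x' (u + \<alpha> *\<^sub>R (y - x))" using x(3) unfolding eq .
    ultimately show ?thesis using x(1)
      by (intro exI[of _ "(x, x')"]) (simp add: near_def blinfun.add_right blinfun.scaleR_right)
  qed
  moreover have "near j p" if jk: "j \<le> k" and p: "near k p" for j k p
  proof -
    have "1 / real (Suc k) \<le> 1 / real (Suc j)" using jk by (intro divide_left_mono) auto
    then show ?thesis using p unfolding near_def by linarith
  qed
  ultimately obtain p where p: "\<And>k. near k (p k)"
    "\<And>\<beta>. \<beta> \<ge> 0 \<Longrightarrow> \<exists>\<^sub>\<infinity>k. c < blinfun_apply (snd (p k)) u + \<beta> * blinfun_apply (snd (p k)) (y - fst (p k))"
    using uniform_slope[of near c "\<lambda>p. blinfun_apply (snd p) u" "\<lambda>p. blinfun_apply (snd p) (y - fst p)"]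
    by blast
  have "(\<lambda>k. fst (p k)) \<longlonglongrightarrow> y"
  proof (rule metric_LIMSEQ_I)
    fix e :: real assume "e > 0"
    then obtain n where n: "1 / Suc n < e" using nat_approx_posE by blast
    have "dist (fst (p k)) y < e" if "k \<ge> n" for k
    proof -
      have "dist (fst (p k)) y < 1 / Suc k" using p(1)[of k] by (simp add: near_def)
      also have "1 / Suc k \<le> 1 / Suc n" using that by (intro divide_left_mono) auto
      finally show ?thesis using n by simp
    qed
    then show "\<exists>n. \<forall>k\<ge>n. dist (fst (p k)) y < e" by blast
  qed
  moreover have "snd (p k) \<in> D f (fst (p k))" for k using p(1)[of k] by (simp add: near_def)
  ultimately obtain w where w: "w \<in> left_open_segment y (y + \<tau> *\<^sub>R u)"
    "limsup (\<lambda>k. ereal (blinfun_apply (snd (p k)) (w - fst (p k))))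
       \<le> ereal (norm (w - y)) * (ereal (inverse (norm u)) * r + ereal \<mu>)"
    using bound[of "\<lambda>k. snd (p k)" "\<lambda>k. fst (p k)"] by blast
  obtain \<theta> where \<theta>: "0 < \<theta>" "w = y + \<theta> *\<^sub>R \<tau> *\<^sub>R u" using w(1) by (auto simp: left_open_segment_def)
  define \<sigma> where "\<sigma> = \<theta> * \<tau>"
  have \<sigma>: "\<sigma> > 0" "w = y + \<sigma> *\<^sub>R u" using \<theta> \<tau> by (simp_all add: \<sigma>_def)
  have "ereal (norm (w - y)) * (ereal (inverse (norm u)) * r + ereal \<mu>) < ereal (\<sigma> * c)"
  proof (cases r)
    case (real \<rho>)
    have "norm (w - y) * (inverse (norm u) * \<rho> + \<mu>) = \<sigma> * (\<rho> + \<mu> * norm u)"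
      using \<sigma> u by (simp add: field_simps)
    also have "\<dots> < \<sigma> * c" using c(1) \<sigma>(1) real by simp
    finally show ?thesis by (simp add: real)
  next
    case PInf
    then show ?thesis using c(1) by simp
  next
    case MInf
    then show ?thesis using \<sigma> u by simp
  qed
  then have "\<forall>\<^sub>F k in sequentially. ereal (blinfun_apply (snd (p k)) (w - fst (p k))) < ereal (\<sigma> * c)"
    using w(2) by (intro Limsup_lessD) (rule le_less_trans)
  then have "\<forall>\<^sub>F k in sequentially. \<not> c < blinfun_apply (snd (p k)) u + inverse \<sigma> * blinfun_apply (snd (p k)) (y - fst (p k))"
  proof eventually_elim
    case (elim k)
    have "w - fst (p k) = \<sigma> *\<^sub>R (u + inverse \<sigma> *\<^sub>R (y - fst (p k)))"
      using \<sigma> by (simp add: algebra_simps)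
    then have "\<sigma> * blinfun_apply (snd (p k)) (u + inverse \<sigma> *\<^sub>R (y - fst (p k))) < \<sigma> * c"
      using elim by (simp add: blinfun.scaleR_right)
    then show ?case using \<sigma>(1) by (simp add: blinfun.add_right blinfun.scaleR_right)
  qed
  moreover have "inverse \<sigma> \<ge> 0" using \<sigma>(1) by simp
  ultimately show False using p(2)[of "inverse \<sigma>"] by (simp add: frequently_def flip: cofinite_eq_sequentially)
qed

section \<open>Absolute continuity and ACG*\<close>

lemma oscillation_attained:
  assumes "continuous_on {c..d} \<phi>" "c \<le> d"
  shows "\<exists>x y. c \<le> x \<and> x \<le> y \<and> y \<le> d \<and> oscillation \<phi> c d = ereal \<bar>\<phi> y - \<phi> x\<bar>"
proof -
  obtain m where m: "m \<in> {c..d}" "\<And>s. s \<in> {c..d} \<Longrightarrow> \<phi> m \<le> \<phi> s"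
    using continuous_attains_inf[of "{c..d}" \<phi>] assms by auto
  obtain M where M: "M \<in> {c..d}" "\<And>s. s \<in> {c..d} \<Longrightarrow> \<phi> s \<le> \<phi> M"
    using continuous_attains_sup[of "{c..d}" \<phi>] assms by auto
  define x where "x = min m M"
  define y where "y = max m M"
  have xy: "c \<le> x" "x \<le> y" "y \<le> d" and val: "\<bar>\<phi> y - \<phi> x\<bar> = \<phi> M - \<phi> m"
    using m M m(2)[OF M(1)] by (auto simp: x_def y_def min_def max_def)
  have "oscillation \<phi> c d \<le> ereal \<bar>\<phi> y - \<phi> x\<bar>"
    unfolding oscillation_def val
  proof (rule Sup_least, clarify)
    fix p q assume "c \<le> p" "p \<le> q" "q \<le> d"
    then have "p \<in> {c..d}" "q \<in> {c..d}" by auto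
    then show "ereal \<bar>\<phi> q - \<phi> p\<bar> \<le> ereal (\<phi> M - \<phi> m)"
      using m(2)[of p] m(2)[of q] M(2)[of p] M(2)[of q] by (simp add: abs_le_iff)
  qed
  moreover have "ereal \<bar>\<phi> y - \<phi> x\<bar> \<le> oscillation \<phi> c d"
    unfolding oscillation_def using xy by (intro Sup_upper) blast
  ultimately show ?thesis using xy by (meson order_antisym)
qed

text \<open>On a full interval the oscillation over a subinterval is the increment over a smaller
  subinterval, whose endpoints still lie in the set.\<close>

lemma abs_cont_on_imp_AC_star_on:
  assumes AC: "abs_cont_on {a..b} \<phi>" and cont: "continuous_on {a..b} \<phi>"
  shows "AC_star_on {a..b} \<phi>"
  unfolding AC_star_on_def
proof (intro allI impI)
  fix \<epsilon> :: real assume "\<epsilon> > 0"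
  then obtain \<delta> where \<delta>: "\<delta> > 0" "\<And>n c d. nonoverlapping_in {a..b} n c d \<Longrightarrow> (\<Sum>i<n. d i - c i) < \<delta> \<Longrightarrow>
       (\<Sum>i<n. \<bar>\<phi> (d i) - \<phi> (c i)\<bar>) < \<epsilon>"
    using AC unfolding abs_cont_on_def by meson
  have "(\<Sum>i<n. oscillation \<phi> (c i) (d i)) < ereal \<epsilon>"
    if non: "nonoverlapping_in {a..b} n c d" and small: "(\<Sum>i<n. d i - c i) < \<delta>" for n c d
  proof -
    have cd: "a \<le> c i" "c i \<le> d i" "d i \<le> b" if "i < n" for i
      using non that by (auto simp: nonoverlapping_in_def)
    have "\<exists>x y. i < n \<longrightarrow> c i \<le> x \<and> x \<le> y \<and> y \<le> d i \<and> oscillation \<phi> (c i) (d i) = ereal \<bar>\<phi> y - \<phi> x\<bar>" for i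
    proof (cases "i < n")
      case True
      then have "continuous_on {c i..d i} \<phi>" using cd[OF True] by (intro continuous_on_subset[OF cont]) auto
      then show ?thesis using oscillation_attained[of "c i" "d i" \<phi>] cd[OF True] by auto
    qed simp
    then obtain x y where xy: "\<And>i. i < n \<Longrightarrow> c i \<le> x i" "\<And>i. i < n \<Longrightarrow> x i \<le> y i" "\<And>i. i < n \<Longrightarrow> y i \<le> d i"
      and osc: "\<And>i. i < n \<Longrightarrow> oscillation \<phi> (c i) (d i) = ereal \<bar>\<phi> (y i) - \<phi> (x i)\<bar>"
      by metis
    have "nonoverlapping_in {a..b} n x y"
      unfolding nonoverlapping_in_def
    proof (intro conjI allI impI)
      fix i assume "i < n"
      then show "x i \<in> {a..b}" "y i \<in> {a..b}" "x i \<le> y i" using xy[of i] cd[of i] by auto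
    next
      fix i j assume ij: "i < n" "j < n" "i \<noteq> j"
      then have "{c i<..<d i} \<inter> {c j<..<d j} = {}" using non by (auto simp: nonoverlapping_in_def)
      moreover have "{x i<..<y i} \<subseteq> {c i<..<d i}" "{x j<..<y j} \<subseteq> {c j<..<d j}"
        using xy[OF ij(1)] xy[OF ij(2)] by auto
      ultimately show "{x i<..<y i} \<inter> {x j<..<y j} = {}" by blast
    qed
    moreover have "(\<Sum>i<n. y i - x i) < \<delta>"
    proof -
      have "(\<Sum>i<n. y i - x i) \<le> (\<Sum>i<n. d i - c i)" by (intro sum_mono) (use xy in \<open>force intro: diff_mono\<close>)
      then show ?thesis using small by simp
    qed
    ultimately have "(\<Sum>i<n. \<bar>\<phi> (y i) - \<phi> (x i)\<bar>) < \<epsilon>" by (rule \<delta>(2))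
    moreover have "(\<Sum>i<n. oscillation \<phi> (c i) (d i)) = (\<Sum>i<n. ereal \<bar>\<phi> (y i) - \<phi> (x i)\<bar>)"
      using osc by (intro sum.cong) auto
    ultimately show ?thesis by simp
  qed
  then show "\<exists>\<delta>>0. \<forall>n c d. nonoverlapping_in {a..b} n c d \<and> (\<Sum>i<n. d i - c i) < \<delta> \<longrightarrow>
       (\<Sum>i<n. oscillation \<phi> (c i) (d i)) < ereal \<epsilon>"
    using \<delta>(1) by blast
qed

lemma AC_star_on_singleton: "AC_star_on {a} \<phi>"
proof -
  have "oscillation \<phi> a a \<le> 0" unfolding oscillation_def
  proof (rule Sup_least, clarify)
    fix p q assume "a \<le> p" "p \<le> q" "q \<le> a"
    then have "p = a" "q = a" by simp_all
    then show "ereal \<bar>\<phi> q - \<phi> p\<bar> \<le> 0" by simp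
  qed
  then have "(\<Sum>i<n. oscillation \<phi> (c i) (d i)) \<le> 0" if "nonoverlapping_in {a} n c d" for n c d
    using that by (intro sum_nonpos) (auto simp: nonoverlapping_in_def)
  then have "(\<Sum>i<n. oscillation \<phi> (c i) (d i)) < ereal \<epsilon>"
    if "\<epsilon> > 0" "nonoverlapping_in {a} n c d" for \<epsilon> n c d
    using that by (meson ereal_less(2) le_less_trans)
  then show ?thesis unfolding AC_star_on_def by (auto intro: exI[of _ 1])
qed

text \<open>The countable cover consists of the exceptional points and of the intervals with rational
  endpoints that avoid them.\<close>

lemma ACG_star_on_off_finite:
  assumes cont: "continuous_on {0..1} \<phi>" and fin: "finite P" and P: "0 \<in> P" "1 \<in> P" "P \<subseteq> {0..1}"
    and AC: "\<And>c d. {c..d} \<subseteq> {0..1} - P \<Longrightarrow> abs_cont_on {c..d} \<phi>"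
  shows "ACG_star_on {0..1} \<phi>"
proof -
  define \<E> where "\<E> = (\<lambda>t. {t}) ` P \<union> {{p..q} | p q. p \<in> \<rat> \<and> q \<in> \<rat> \<and> {p..q} \<subseteq> {0..1} - P}"
  have "{{p..q} | p q. p \<in> \<rat> \<and> q \<in> \<rat> \<and> {p..q} \<subseteq> {0..1} - P} \<subseteq> (\<lambda>(p, q). {p..q}) ` (\<rat> \<times> \<rat>)" by auto
  moreover have "countable ((\<lambda>(p, q). {p..q}) ` (\<rat> \<times> \<rat> :: (real \<times> real) set))"
    by (intro countable_image countable_SIGMA countable_rat)
  ultimately have "countable \<E>"
    unfolding \<E>_def using fin by (auto simp: countable_finite intro: countable_subset)
  moreover have "\<E> \<noteq> {}" using P by (auto simp: \<E>_def)
  ultimately obtain E :: "nat \<Rightarrow> real set" where E: "\<E> = range E"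
    by (metis range_from_nat_into)
  have "AC_star_on A \<phi>" if "A \<in> \<E>" for A
  proof -
    consider t where "A = {t}" | p q where "A = {p..q}" "{p..q} \<subseteq> {0..1} - P"
      using \<open>A \<in> \<E>\<close> by (auto simp: \<E>_def)
    then show ?thesis
    proof cases
      case (2 p q)
      have "continuous_on {p..q} \<phi>" by (rule continuous_on_subset[OF cont]) (use 2 in blast)
      then show ?thesis using abs_cont_on_imp_AC_star_on AC 2 by blast
    qed (simp add: AC_star_on_singleton)
  qed
  moreover have "{0..1} = \<Union>\<E>"
  proof
    show "\<Union>\<E> \<subseteq> {0..1}" using P(3) by (auto simp: \<E>_def)
    show "{0..1} \<subseteq> \<Union>\<E>"
    proof
      fix t :: real assume t: "t \<in> {0..1}"
      show "t \<in> \<Union>\<E>"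
      proof (cases "t \<in> P")
        case False
        have "open ({0<..<1} - P)" using fin by (intro open_Diff finite_imp_closed) auto
        moreover have "t \<in> {0<..<1} - P"
        proof -
          have "t \<noteq> 0" "t \<noteq> 1" using False P by auto
          then show ?thesis using t False by auto
        qed
        ultimately obtain e where e: "e > 0" "ball t e \<subseteq> {0<..<1} - P" by (meson open_contains_ball)
        obtain p where p: "p \<in> \<rat>" "t - e < p" "p < t" using Rats_dense_in_real[of "t - e" t] e by auto
        obtain q where q: "q \<in> \<rat>" "t < q" "q < t + e" using Rats_dense_in_real[of t "t + e"] e by auto
        have "{p..q} \<subseteq> ball t e" using p q by (auto simp: dist_real_def)
        then have "{p..q} \<subseteq> {0..1} - P" using e(2) by fastforce
        then have "{p..q} \<in> \<E>" using p q by (auto simp: \<E>_def)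
        then show ?thesis using p q by (intro UnionI[of "{p..q}"]) auto
      qed (auto simp: \<E>_def)
    qed
  qed
  ultimately show ?thesis unfolding ACG_star_on_def using cont E by auto
qed

section \<open>Essentially directionally smooth functions\<close>

lemma AE_lebesgue_Icc_full_measure:
  fixes T :: "real set"
  assumes "T \<subseteq> {0..1}" "T \<in> sets lebesgue" "measure lebesgue T = 1"
  shows "AE t\<in>{0..1} in lebesgue. t \<in> T"
proof -
  have T: "emeasure lebesgue T = 1"
    using assms(3) by (cases "emeasure lebesgue T") (auto simp: measure_def)
  have Icc_sets: "{0..1::real} \<in> sets lebesgue" by (intro sets_completionI_sets) simp
  have Icc: "emeasure lebesgue {0..1::real} = 1"
    by (subst emeasure_completion[OF Icc_sets]) (simp add: main_part_sets)
  have "emeasure lebesgue ({0..1} - T) = emeasure lebesgue {0..1::real} - emeasure lebesgue T"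
    by (rule emeasure_Diff[OF _ Icc_sets assms(2,1)]) (unfold T, simp)
  also have "\<dots> = 0" unfolding T Icc by simp
  finally have "{0..1} - T \<in> null_sets lebesgue"
    using Icc_sets assms(2) by (intro null_setsI sets.Diff)
  then show ?thesis by (rule AE_I') auto
qed

lemma continuous_on_line_real:
  assumes "\<And>t. t \<in> {0..1} \<Longrightarrow> \<bar>on_line g u v t\<bar> \<noteq> \<infinity>" "continuous_on {0..1} (on_line g u v)"
  shows "continuous_on {0..1} (\<lambda>t. real_of_ereal (on_line g u v t))"
  using assms continuous_on_iff_real[of "{0..1}" "on_line g u v"] by (simp add: o_def)

lemma
  assumes g: "eds D g" and u: "u \<in> edom g" and v: "v \<in> edom g" and "v \<noteq> u"
  shows eds_finite_on_line: "t \<in> {0..1} \<Longrightarrow> \<bar>on_line g u v t\<bar> \<noteq> \<infinity>"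
    and eds_continuous_on_line: "continuous_on {0..1} (on_line g u v)"
    and eds_abs_cont_off_finite: "\<exists>(p::nat) \<tau>. \<tau> 0 = 0 \<and> \<tau> p = 1 \<and> (\<forall>i<p. \<tau> i < \<tau> (Suc i)) \<and>
         (\<forall>c d. {c..d} \<subseteq> {0..1} - \<tau> ` {..p} \<longrightarrow>
            abs_cont_on {c..d} (\<lambda>t. real_of_ereal (on_line g u v t)))"
    and eds_subgradient_bound: "\<mu> > 0 \<Longrightarrow> \<exists>T. T \<subseteq> {0..1} \<and> T \<in> sets lebesgue \<and> measure lebesgue T = 1 \<and>
         (\<forall>t\<in>T. \<forall>(x :: nat \<Rightarrow> 'a::real_normed_vector) x'.
            (\<forall>k. x' k \<in> D g (x k)) \<and> x \<longlonglongrightarrow> u + t *\<^sub>R (v - u) \<longrightarrow>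
            (\<exists>w\<in>left_open_segment (u + t *\<^sub>R (v - u)) v.
               limsup (\<lambda>k. ereal (blinfun_apply (x' k) (w - x k)))
               \<le> ereal (norm (w - (u + t *\<^sub>R (v - u)))) *
                 (ereal (inverse (norm (v - u))) * radial_subderiv (on_line g u v) t 1
                  + ereal \<mu>)))"
proof -
  note E = mp[OF bspec[OF bspec[OF conjunct2[OF g[unfolded eds_def]] u] v] \<open>v \<noteq> u\<close>]
  show "t \<in> {0..1} \<Longrightarrow> \<bar>on_line g u v t\<bar> \<noteq> \<infinity>" by (rule bspec[OF conjunct1[OF E]])
  show "continuous_on {0..1} (on_line g u v)" by (rule conjunct1[OF conjunct2[OF E]])
  note E' = conjunct2[OF conjunct2[OF E]]
  from conjunct1[OF E'] show "\<exists>(p::nat) \<tau>. \<tau> 0 = 0 \<and> \<tau> p = 1 \<and> (\<forall>i<p. \<tau> i < \<tau> (Suc i)) \<and>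
         (\<forall>c d. {c..d} \<subseteq> {0..1} - \<tau> ` {..p} \<longrightarrow>
            abs_cont_on {c..d} (\<lambda>t. real_of_ereal (on_line g u v t)))" .
  show "\<exists>T. T \<subseteq> {0..1} \<and> T \<in> sets lebesgue \<and> measure lebesgue T = 1 \<and>
         (\<forall>t\<in>T. \<forall>(x :: nat \<Rightarrow> 'a) x'.
            (\<forall>k. x' k \<in> D g (x k)) \<and> x \<longlonglongrightarrow> u + t *\<^sub>R (v - u) \<longrightarrow>
            (\<exists>w\<in>left_open_segment (u + t *\<^sub>R (v - u)) v.
               limsup (\<lambda>k. ereal (blinfun_apply (x' k) (w - x k)))
               \<le> ereal (norm (w - (u + t *\<^sub>R (v - u)))) *
                 (ereal (inverse (norm (v - u))) * radial_subderiv (on_line g u v) t 1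
                  + ereal \<mu>)))" if "\<mu> > 0"
    using mp[OF spec[OF conjunct2[OF E']] that] .
qed

lemma eds_ACG_star_on_segment:
  assumes g: "eds D g" and u: "u \<in> edom g" and v: "v \<in> edom g" and "v \<noteq> u"
  shows "ACG_star_on {0..1} (\<lambda>t. real_of_ereal (g (u + t *\<^sub>R (v - u))))"
proof -
  obtain p :: nat and \<tau> :: "nat \<Rightarrow> real" where \<tau>: "\<tau> 0 = 0" "\<tau> p = 1" "\<And>i. i < p \<Longrightarrow> \<tau> i < \<tau> (Suc i)"
    "\<And>c d. {c..d} \<subseteq> {0..1} - \<tau> ` {..p} \<Longrightarrow> abs_cont_on {c..d} (\<lambda>t. real_of_ereal (on_line g u v t))"
    using eds_abs_cont_off_finite[OF assms] by blast
  have mono: "\<tau> i \<le> \<tau> j" if "i \<le> j" "j \<le> p" for i j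
    using that
  proof (induction rule: dec_induct)
    case (step n)
    then show ?case using \<tau>(3)[of n] by simp
  qed simp
  have "ACG_star_on {0..1} (\<lambda>t. real_of_ereal (on_line g u v t))"
  proof (rule ACG_star_on_off_finite[where P = "\<tau> ` {..p}"])
    show "continuous_on {0..1} (\<lambda>t. real_of_ereal (on_line g u v t))"
      by (rule continuous_on_line_real[OF eds_finite_on_line eds_continuous_on_line]) (use assms in blast)+
    show "0 \<in> \<tau> ` {..p}" "1 \<in> \<tau> ` {..p}" using \<tau>(1,2) by (metis atMost_iff image_eqI le0, metis atMost_iff image_eqI order_refl)
    show "\<tau> ` {..p} \<subseteq> {0..1}" using mono[of 0] mono[of _ p] \<tau>(1,2) by auto
  qed (use \<tau>(4) in auto)
  then show ?thesis by (simp add: on_line_def)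
qed

lemma eds_LACG_star:
  assumes g: "eds D g" shows "g \<in> LACG_star"
  unfolding LACG_star_def
proof (intro CollectI conjI allI impI)
  show "lsc_proper g" using g by (simp add: eds_def)
  fix a b assume ab: "closed_segment a b \<subseteq> edom g"
  show "ACG_star_on {0..1} (\<lambda>t. real_of_ereal (g (a + t *\<^sub>R (b - a))))"
  proof (cases "b = a")
    case True
    have "abs_cont_on {c..d} (\<lambda>t. r)" for c d r :: real
      unfolding abs_cont_on_def by (auto intro: exI[of _ 1])
    then show ?thesis unfolding True
      by (intro ACG_star_on_off_finite[where P = "{0, 1}"]) auto
  qed (use eds_ACG_star_on_segment[OF g] ab in auto)
qed

lemma eds_convex_edom:
  assumes g: "eds D g" shows "convex (edom g)"
  unfolding convex_contains_segment
proof (intro ballI)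
  fix a b assume ab: "a \<in> edom g" "b \<in> edom g"
  show "closed_segment a b \<subseteq> edom g"
  proof (cases "b = a")
    case False
    have "g (a + t *\<^sub>R (b - a)) < \<infinity>" if "t \<in> {0..1}" for t
      using eds_finite_on_line[OF g ab False that] by (auto simp: on_line_def)
    moreover have "\<exists>t\<in>{0..1}. x = a + t *\<^sub>R (b - a)" if "x \<in> closed_segment a b" for x
      using that by (auto simp: in_segment algebra_simps)
    ultimately show ?thesis unfolding edom_def by blast
  qed (use ab in auto)
qed

text \<open>The full-measure sets are intersected over \<open>\<mu> = 1/(n + 1)\<close>. The right endpoint \<open>t = 1\<close> is left out,
  for there the half-open segment in the eds property is degenerate.\<close>

lemma eds_ae_natnat_le:
  fixes D :: "('a::banach \<Rightarrow> ereal) \<Rightarrow> 'a \<Rightarrow> ('a \<Rightarrow>\<^sub>L real) set"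
  assumes D: "subdifferential D" and g: "eds D g" and x: "x \<in> edom g" "x + u \<in> edom g" and u: "u \<noteq> 0"
  shows "AE t\<in>{0..1} in lebesgue.
    natnat_subderiv g (x + t *\<^sub>R u) u \<le> radial_subderiv g (x + t *\<^sub>R u) u"
proof -
  have lsc: "lsc_proper g" using g by (simp add: eds_def)
  have ne: "x + u \<noteq> x" using u by simp
  have step: "AE t\<in>{0..1} in lebesgue. natnat_subderiv g (x + t *\<^sub>R u) u
      \<le> radial_subderiv g (x + t *\<^sub>R u) u + ereal (\<mu> * norm u)" if \<mu>: "\<mu> > 0" for \<mu>
  proof -
    from eds_subgradient_bound[OF g x ne \<mu>] obtain T
      where T: "T \<subseteq> {0..1}" "T \<in> sets lebesgue" "measure lebesgue T = 1"
      and bound: "\<forall>t\<in>T. \<forall>xs x'. (\<forall>k. x' k \<in> D g (xs k)) \<and> xs \<longlonglongrightarrow> x + t *\<^sub>R (x + u - x) \<longrightarrow>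
            (\<exists>w\<in>left_open_segment (x + t *\<^sub>R (x + u - x)) (x + u).
               limsup (\<lambda>k. ereal (blinfun_apply (x' k) (w - xs k)))
               \<le> ereal (norm (w - (x + t *\<^sub>R (x + u - x)))) *
                 (ereal (inverse (norm (x + u - x))) * radial_subderiv (on_line g x (x + u)) t 1
                  + ereal \<mu>))"
      by (elim exE conjE)
    have "natnat_subderiv g (x + t *\<^sub>R u) u \<le> radial_subderiv g (x + t *\<^sub>R u) u + ereal (\<mu> * norm u)"
      if t: "t \<in> T" "t \<noteq> 1" for t
    proof -
      have rad: "radial_subderiv (on_line g x (x + u)) t 1 = radial_subderiv g (x + t *\<^sub>R u) u"
        by (simp add: radial_subderiv_def edom_def on_line_def algebra_simps)
      have "1 - t > 0" using t T(1) by force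
      have end_eq: "x + u = x + t *\<^sub>R u + (1 - t) *\<^sub>R u" by (simp add: algebra_simps)
      show ?thesis
      proof (rule natnat_subderiv_le_of_subgradient_bound[OF D lsc u \<open>1 - t > 0\<close>])
        fix xs x' assume "\<And>k. x' k \<in> D g (xs k)" "xs \<longlonglongrightarrow> x + t *\<^sub>R u"
        then show "\<exists>w\<in>left_open_segment (x + t *\<^sub>R u) (x + t *\<^sub>R u + (1 - t) *\<^sub>R u).
          limsup (\<lambda>k. ereal (blinfun_apply (x' k) (w - xs k))) \<le> ereal (norm (w - (x + t *\<^sub>R u))) *
             (ereal (inverse (norm u)) * radial_subderiv g (x + t *\<^sub>R u) u + ereal \<mu>)"
          using bspec[OF bound t(1)] unfolding rad end_eq[symmetric] by simp
      qed
    qed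
    moreover have "AE t in lebesgue. t \<noteq> (1::real)"
      by (rule AE_I'[of "{1}"]) auto
    ultimately show ?thesis using AE_lebesgue_Icc_full_measure[OF T] by (auto elim!: eventually_elim2)
  qed
  have "AE t in lebesgue. \<forall>n::nat. t \<in> {0..1} \<longrightarrow> natnat_subderiv g (x + t *\<^sub>R u) u
      \<le> radial_subderiv g (x + t *\<^sub>R u) u + ereal (1 / real (Suc n) * norm u)"
    unfolding AE_all_countable by (intro allI step) simp
  then show ?thesis
  proof eventually_elim
    case (elim t)
    show ?case
    proof
      assume t: "t \<in> {0..1}"
      show "natnat_subderiv g (x + t *\<^sub>R u) u \<le> radial_subderiv g (x + t *\<^sub>R u) u"
      proof (rule ereal_le_epsilon2)
        fix e :: real assume "0 < e"
        then obtain n where n: "1 / real (Suc n) < e / norm u" using nat_approx_posE[of "e / norm u"] u by auto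
        then have "1 / real (Suc n) * norm u \<le> e" using u by (simp add: field_simps)
        then show "natnat_subderiv g (x + t *\<^sub>R u) u \<le> radial_subderiv g (x + t *\<^sub>R u) u + ereal e"
          using elim t by (meson add_left_mono ereal_less_eq(3) order_trans)
      qed
    qed
  qed
qed

text \<open>The eds property says nothing about the direction \<open>u = 0\<close>, which is treated directly.\<close>

lemma radial_subderiv_zero:
  assumes "lsc_proper f" shows "radial_subderiv f y 0 = (if y \<in> edom f then 0 else -\<infinity>)"
proof (cases "y \<in> edom f")
  case True
  then obtain r where "f y = ereal r"
    using assms by (cases "f y") (auto simp: edom_def lsc_proper_def proper_def)
  then have "radial_subderiv f y 0 = Liminf (at_right (0::real)) (\<lambda>t. (ereal r - ereal r) / ereal t)"
    using True by (simp add: radial_subderiv_def)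
  also have "\<dots> = Liminf (at_right (0::real)) (\<lambda>t. ereal 0)"
    by (intro Liminf_eq) (auto simp: eventually_at_right_field intro: exI[of _ 1])
  finally show ?thesis using True by (simp add: Liminf_const zero_ereal_def)
qed (simp add: radial_subderiv_def)

lemma natnat_subderiv_zero_le:
  assumes "lsc_proper f" "x \<in> edom f"
  shows "natnat_subderiv f x 0 \<le> radial_subderiv f x 0"
proof -
  have "natnat_subderiv f x 0 \<le> Limsup (nhds x) (\<lambda>y. radial_subderiv f y (0 + 0 *\<^sub>R (x - y)))"
    unfolding natnat_subderiv_def by (rule INF_lower) simp
  also have "\<dots> \<le> 0"
    using radial_subderiv_zero[OF assms(1)] by (intro Limsup_bounded always_eventually) simp
  finally show ?thesis using radial_subderiv_zero[OF assms(1)] assms(2) by simp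
qed

lemma eds_radial_le_nat:
  assumes g: "eds D g" and seg: "closed_segment x (x + u) \<subseteq> edom g" and t: "0 \<le> t" "t < 1"
  shows "radial_subderiv g (x + t *\<^sub>R u) u \<le> nat_subderiv g (x + t *\<^sub>R u) u"
proof (rule radial_subderiv_le_nat[where h = "1 - t" and \<gamma> = "\<lambda>s. real_of_ereal (g (x + (t + s) *\<^sub>R u))"])
  show "1 - t > 0" using t by simp
  have proper: "g y \<noteq> -\<infinity>" for y using g by (simp add: eds_def lsc_proper_def proper_def)
  show "g (x + t *\<^sub>R u + s *\<^sub>R u) = ereal (real_of_ereal (g (x + (t + s) *\<^sub>R u)))"
    if "0 \<le> s" "s \<le> 1 - t" for s
  proof -
    have "x + (t + s) *\<^sub>R u = (1 - (t + s)) *\<^sub>R x + (t + s) *\<^sub>R (x + u)" by (simp add: algebra_simps)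
    then have "x + (t + s) *\<^sub>R u \<in> closed_segment x (x + u)"
      unfolding in_segment using that t by (intro exI[of _ "t + s"]) auto
    then have "\<bar>g (x + (t + s) *\<^sub>R u)\<bar> \<noteq> \<infinity>" using seg proper by (auto simp: edom_def)
    then show ?thesis by (simp add: ereal_real' algebra_simps)
  qed
  have "continuous_on {0..1} (\<lambda>t. real_of_ereal (g (x + t *\<^sub>R (x + u - x))))"
    using eds_LACG_star[OF g] seg unfolding LACG_star_def ACG_star_on_def by blast
  then have "continuous_on {0..1} (\<lambda>t. real_of_ereal (g (x + t *\<^sub>R u)))" by simp
  then show "continuous_on {0..1 - t} (\<lambda>s. real_of_ereal (g (x + (t + s) *\<^sub>R u)))"
    by (rule continuous_on_compose2) (use t in \<open>auto intro!: continuous_intros\<close>)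
qed

theorem proposition5p1:
  fixes D :: "('a::banach \<Rightarrow> ereal) \<Rightarrow> 'a \<Rightarrow> ('a \<Rightarrow>\<^sub>L real) set"
  assumes "subdifferential D"
  shows "(\<forall>g. eds D g \<longrightarrow>
            g \<in> LACG_star \<and>
            (\<forall>xbar u. closed_segment xbar (xbar + u) \<subseteq> edom g \<longrightarrow>
               (AE t\<in>{0..1} in lebesgue.
                  natnat_subderiv g (xbar + t *\<^sub>R u) u = radial_subderiv g (xbar + t *\<^sub>R u) u)))
         \<and> {g. eds D g} \<subseteq> LACG_star_nat_ae"
proof -
  have le: "AE t\<in>{0..1} in lebesgue. natnat_subderiv g (x + t *\<^sub>R u) u \<le> radial_subderiv g (x + t *\<^sub>R u) u"
    if g: "eds D g" and seg: "closed_segment x (x + u) \<subseteq> edom g" for g x u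
  proof (cases "u = 0")
    case True
    have "lsc_proper g" using g by (simp add: eds_def)
    then have "natnat_subderiv g x 0 \<le> radial_subderiv g x 0"
      by (rule natnat_subderiv_zero_le) (use seg in auto)
    then show ?thesis using True by simp
  next
    case False
    then show ?thesis using eds_ae_natnat_le[OF assms g _ _ False] seg by auto
  qed
  have natnat: "AE t\<in>{0..1} in lebesgue. natnat_subderiv g (x + t *\<^sub>R u) u = radial_subderiv g (x + t *\<^sub>R u) u"
    if "eds D g" "closed_segment x (x + u) \<subseteq> edom g" for g x u
    using le[OF that] by eventually_elim (meson antisym radial_subderiv_le_natnat)
  have nat: "AE t\<in>{0..1} in lebesgue. nat_subderiv g (x + t *\<^sub>R u) u = radial_subderiv g (x + t *\<^sub>R u) u"
    if "eds D g" "closed_segment x (x + u) \<subseteq> edom g" for g x u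
  proof -
    have "AE t in lebesgue. t \<noteq> (1::real)"
      by (rule AE_I'[of "{1}"]) auto
    with le[OF that] show ?thesis
    proof eventually_elim
      case (elim t)
      show ?case
      proof
        assume "t \<in> {0..1}"
        then have "0 \<le> t" "t < 1" using elim by auto
        then show "nat_subderiv g (x + t *\<^sub>R u) u = radial_subderiv g (x + t *\<^sub>R u) u"
          using elim(1) \<open>t \<in> {0..1}\<close> nat_le_natnat eds_radial_le_nat[OF that]
          by (meson antisym order_trans)
      qed
    qed
  qed
  show ?thesis
    using eds_LACG_star eds_convex_edom natnat nat unfolding LACG_star_nat_ae_def by blast
qed

end
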